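(* Let $G=(V,E)$ be a planar directed graph with edge costs $c:E\to\mathbb{R}_{\ge0}$, root $r\in V$ and terminal set $S\subseteq V\setminus\{r\}$ with $k=|S|$. Then the integrality gap of the linear program $$\min \sum_{e\in E} c_e x_e \quad\text{s.t.}\quad \sum_{e\in\delta^+(U)} x_e\ge 1\ \ \forall U\in\mathcal{C},\qquad x_e\ge 0\ \ \forall e\in E,$$ where $\mathcal{C}=\{U\subseteq V: r\in U,\ S\not\subseteq U\}$ and $\delta^+(U)=\{(u,v)\in E: u\in U, v\notin U\}$, is $O(\log^2 k)$; i.e., for every feasible solution $x$ there is an $r$-tree in $G$ containing all terminals of $S$ whose cost is $O(\log^2 k)\sum_{e\in E}c_e x_e$.
   Context: A planar directed graph is a directed graph whose underlying undirected graph is planar. An $r$-tree is a subgraph of $G$ that is a directed out-tree rooted at $r$. This LP is the natural cut-based relaxation of the Directed Steiner Tree problem: find a minimum-cost $r$-tree containing all terminals. *)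

theory Defs
  imports
    "HOL-Analysis.Analysis"
    "HOL-Library.Landau_Symbols"
    "Graph_Theory.Digraph_Component"
begin

(* A drawing of the undirected graph (V, E) in the plane, taken to be the type complex; the elements
   of E are sets {u, v} of vertices. The vertex v is drawn at p v and the edge e along g e. A
   simple_path may be closed, so this covers loops (e = {u}) as simple closed curves; as p is
   injective on V, any other edge is drawn along an arc. *)
definition planar_drawing ::
  "'a set \<Rightarrow> 'a set set \<Rightarrow> ('a \<Rightarrow> complex) \<Rightarrow> ('a set \<Rightarrow> real \<Rightarrow> complex) \<Rightarrow> bool" where
  "planar_drawing V E p g \<longleftrightarrow>
     inj_on p V \<and>
     (\<forall>e\<in>E. simple_path (g e) \<and> {pathstart (g e), pathfinish (g e)} = p ` e \<and>
        path_image (g e) \<inter> p ` V = p ` e) \<and>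
     (\<forall>e\<in>E. \<forall>f\<in>E. e \<noteq> f \<longrightarrow> path_image (g e) \<inter> path_image (g f) \<subseteq> p ` V)"

definition planar_graph :: "'a set \<Rightarrow> 'a set set \<Rightarrow> bool" where
  "planar_graph V E \<longleftrightarrow> (\<exists>p g. planar_drawing V E p g)"

(* Antiparallel arcs (u, v) and (v, u) give the same undirected edge. *)
definition underlying_edges :: "'a pair_pre_digraph \<Rightarrow> 'a set set" where
  "underlying_edges G = {{u, v} | u v. (u, v) \<in> parcs G}"

definition planar_digraph :: "'a pair_pre_digraph \<Rightarrow> bool" where
  "planar_digraph G \<longleftrightarrow> planar_graph (pverts G) (underlying_edges G)"

(* Uniqueness is required among all walks from r, not just among paths: this is what excludes arcs
   back into the root or to an ancestor. *)
definition out_tree :: "'a \<Rightarrow> 'a pair_pre_digraph \<Rightarrow> bool" where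
  "out_tree r T \<longleftrightarrow> pair_wf_digraph T \<and> r \<in> pverts T \<and>
     (\<forall>v\<in>pverts T. \<exists>!q. pre_digraph.awalk T r q v)"

definition r_tree :: "'a pair_pre_digraph \<Rightarrow> 'a \<Rightarrow> 'a pair_pre_digraph \<Rightarrow> bool" where
  "r_tree G r T \<longleftrightarrow> subgraph T G \<and> out_tree r T"

definition delta_out :: "'a pair_pre_digraph \<Rightarrow> 'a set \<Rightarrow> ('a \<times> 'a) set" where
  "delta_out G U = {(u, v). (u, v) \<in> parcs G \<and> u \<in> U \<and> v \<notin> U}"

definition steiner_cuts :: "'a pair_pre_digraph \<Rightarrow> 'a \<Rightarrow> 'a set \<Rightarrow> 'a set set" where
  "steiner_cuts G r S = {U. U \<subseteq> pverts G \<and> r \<in> U \<and> \<not> S \<subseteq> U}"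

definition lp_feasible ::
  "'a pair_pre_digraph \<Rightarrow> 'a \<Rightarrow> 'a set \<Rightarrow> ('a \<times> 'a \<Rightarrow> real) \<Rightarrow> bool" where
  "lp_feasible G r S x \<longleftrightarrow>
     (\<forall>U\<in>steiner_cuts G r S. (\<Sum>e\<in>delta_out G U. x e) \<ge> 1) \<and> (\<forall>e\<in>parcs G. x e \<ge> 0)"

end

theory Submission
  imports Defs
begin

text \<open>The tree is bought recursively. Let \<open>X\<close> be the set of vertices bought so far, \<open>C\<close> a component of the rest
  and \<open>L\<close> the cost of the fractional solution inside \<open>C\<close>. Deleting all vertices at distance more than about
  \<open>L log k\<close> from \<open>X\<close> destroys only a \<open>1 / log k\<close> fraction of every cut. Then a planar separator made of at most
  eight short walks from \<open>X\<close> is bought, at cost \<open>O(L log k)\<close>, after which every component contains at most half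
  of the terminals. The cuts of the components only use arcs inside them, so their costs add up to
  at most \<open>L\<close>; each of the \<open>O(log k)\<close> levels of the recursion therefore costs \<open>O(log k)\<close> times the LP value.

  The separator theorem needs neither faces nor rotation systems: the drawing is replaced by a fine lattice,
  each lattice point is joined to the root by a lattice walk close to the drawing of some walk
  of the graph, and a Sperner type argument on winding numbers finds a unit square whose corners' walks
  separate.\<close>

section \<open>Reachability and connectedness inside a vertex set\<close>

definition linked :: "('a \<Rightarrow> 'a \<Rightarrow> bool) \<Rightarrow> 'a set \<Rightarrow> ('a \<times> 'a) set" where
  "linked R Z = {(a, b). a \<in> Z \<and> b \<in> Z \<and> R a b}\<^sup>*"

definition conn :: "('a \<Rightarrow> 'a \<Rightarrow> bool) \<Rightarrow> 'a set \<Rightarrow> bool" where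
  "conn R Z \<longleftrightarrow> (\<forall>x\<in>Z. \<forall>y\<in>Z. (x, y) \<in> linked R Z)"

lemma linked_refl [simp]: "(x, x) \<in> linked R Z"
  by (simp add: linked_def)

lemma linked_trans: "(x, y) \<in> linked R Z \<Longrightarrow> (y, z) \<in> linked R Z \<Longrightarrow> (x, z) \<in> linked R Z"
  by (simp add: linked_def)

lemma linked_edge: "x \<in> Z \<Longrightarrow> y \<in> Z \<Longrightarrow> R x y \<Longrightarrow> (x, y) \<in> linked R Z"
  by (auto simp: linked_def)

lemma linked_mono: "(x, y) \<in> linked R Z \<Longrightarrow> Z \<subseteq> Z' \<Longrightarrow> (x, y) \<in> linked R Z'"
  unfolding linked_def by (rule rtrancl_mono[THEN subsetD]) auto

lemma linked_sym:
  assumes "symp R" "(x, y) \<in> linked R Z" shows "(y, x) \<in> linked R Z"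
proof -
  have "sym {(a, b). a \<in> Z \<and> b \<in> Z \<and> R a b}"
    using assms(1) by (auto simp: sym_def symp_def)
  then show ?thesis
    using assms(2) unfolding linked_def by (meson symE sym_rtrancl)
qed

lemma linked_induct [consumes 1, case_names base step]:
  assumes "(x, y) \<in> linked R Z" "P x"
    and "\<And>a b. (x, a) \<in> linked R Z \<Longrightarrow> a \<in> Z \<Longrightarrow> b \<in> Z \<Longrightarrow> R a b \<Longrightarrow> P a \<Longrightarrow> P b"
  shows "P y"
  using assms(1) unfolding linked_def
  by (induction rule: rtrancl_induct) (use assms in \<open>auto simp: linked_def\<close>)

lemma linked_in: "(x, y) \<in> linked R Z \<Longrightarrow> x \<in> Z \<Longrightarrow> y \<in> Z"
  by (induction rule: linked_induct) auto

lemma conn_from: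
  assumes "symp R" "\<And>y. y \<in> Z \<Longrightarrow> (x, y) \<in> linked R Z"
  shows "conn R Z"
  unfolding conn_def by (meson assms linked_sym linked_trans)

lemma connD: "conn R Z \<Longrightarrow> x \<in> Z \<Longrightarrow> y \<in> Z \<Longrightarrow> (x, y) \<in> linked R Z"
  by (simp add: conn_def)

lemma conn_component:
  assumes "symp R" shows "conn R {y \<in> Z. (x, y) \<in> linked R Z}"
proof (cases "x \<in> Z")
  case True
  let ?K = "{y \<in> Z. (x, y) \<in> linked R Z}"
  have "(x, y) \<in> linked R ?K" if "(x, y) \<in> linked R Z" for y
    using that
  proof (induction rule: linked_induct)
    case (step a b)
    have "(x, b) \<in> linked R Z"
      by (rule linked_trans[OF step(1) linked_edge]) (use step in auto)
    then have "(a, b) \<in> linked R ?K"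
      using step by (intro linked_edge) auto
    with step(5) show ?case by (rule linked_trans)
  qed simp
  then show ?thesis by (intro conn_from[OF assms, of _ x]) simp
next
  case False
  then have "(x, y) \<notin> linked R Z" if "y \<in> Z" for y
    using that linked_in linked_sym[OF assms] by metis
  then show ?thesis unfolding conn_def by blast
qed

section \<open>Winding numbers on the square lattice\<close>

definition gadj :: "int \<times> int \<Rightarrow> int \<times> int \<Rightarrow> bool" where
  "gadj a b \<longleftrightarrow> \<bar>fst a - fst b\<bar> + \<bar>snd a - snd b\<bar> = 1"

lemma symp_gadj: "symp gadj"
  by (auto simp: symp_def gadj_def)

text \<open>The signed number of crossings of the step from \<open>a\<close> to \<open>b\<close> with the vertical ray starting in the
  centre of the unit square whose lower left corner is \<open>q\<close>. Summed along a closed lattice walk, it is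
  the winding number of the walk around that centre.\<close>

definition cross :: "int \<times> int \<Rightarrow> int \<times> int \<Rightarrow> int \<times> int \<Rightarrow> int" where
  "cross q a b =
     (if snd a = snd b \<and> snd a > snd q
      then if fst a = fst q \<and> fst b = fst q + 1 then 1
           else if fst b = fst q \<and> fst a = fst q + 1 then -1 else 0
      else 0)"

text \<open>The signed indicator of the lattice points in the half-strip between the rays of two
  horizontally adjacent squares. For vertically adjacent squares one ray contains the other, and the
  value is 0.\<close>

definition ray :: "int \<times> int \<Rightarrow> int \<times> int \<Rightarrow> int \<times> int \<Rightarrow> int" where
  "ray q q' z =
     (if fst q' = fst q + 1 then of_bool (fst z = fst q' \<and> snd z > snd q)
      else if fst q = fst q' + 1 then - of_bool (fst z = fst q \<and> snd z > snd q)
      else 0)"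

text \<open>The crossings differ by whether the step enters or leaves the half-strip between the
  rays. A step through the segment joining the two centres would have \<open>q\<close> or
  \<open>q'\<close> as an endpoint, which is excluded.\<close>

lemma cross_diff:
  assumes "gadj q q'" "gadj a b" "q \<notin> {a, b}" "q' \<notin> {a, b}"
  shows "cross q a b - cross q' a b = ray q q' b - ray q q' a"
proof -
  obtain i j i' j' a1 a2 b1 b2 where e: "q = (i, j)" "q' = (i', j')" "a = (a1, a2)" "b = (b1, b2)"
    by (metis surj_pair)
  have 1: "(i' = i + 1 \<and> j' = j) \<or> (i = i' + 1 \<and> j' = j) \<or> (i' = i \<and> j' = j + 1) \<or> (i' = i \<and> j = j' + 1)"
    using assms(1) by (auto simp: e gadj_def)
  have 2: "(b1 = a1 + 1 \<and> b2 = a2) \<or> (a1 = b1 + 1 \<and> b2 = a2) \<or> (b1 = a1 \<and> b2 = a2 + 1) \<or> (b1 = a1 \<and> a2 = b2 + 1)"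
    using assms(2) by (auto simp: e gadj_def)
  show ?thesis
    using 1 2 assms(3,4)
    by (elim disjE conjE) (auto simp: e cross_def ray_def)
qed

text \<open>\<open>w q\<close> counts the signed crossings of a walk from \<open>x0\<close> to
  \<open>x\<close> in \<open>Z\<close> with the ray of \<open>q\<close>. Summed along the walk,
  \<open>cross_diff\<close> telescopes, so the jumps of \<open>w\<close> depend only on the ends of
  the walk.\<close>

lemma lattice_chain:
  assumes "(x0, x) \<in> linked gadj Z"
  shows "\<exists>w :: int \<times> int \<Rightarrow> int. \<forall>q q'. gadj q q' \<longrightarrow> q \<notin> Z \<longrightarrow> q' \<notin> Z \<longrightarrow>
           w q - w q' = ray q q' x - ray q q' x0"
  using assms
proof (induction rule: linked_induct)
  case base
  then show ?case by (intro exI[of _ "\<lambda>_. 0"]) auto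
next
  case (step a b)
  then obtain w :: "int \<times> int \<Rightarrow> int" where w: "\<And>q q'. gadj q q' \<Longrightarrow> q \<notin> Z \<Longrightarrow> q' \<notin> Z \<Longrightarrow>
           w q - w q' = ray q q' a - ray q q' x0" by blast
  show ?case
  proof (intro exI[of _ "\<lambda>q. w q + cross q a b"] allI impI)
    fix q q' assume q: "gadj q q'" "q \<notin> Z" "q' \<notin> Z"
    have "cross q a b - cross q' a b = ray q q' b - ray q q' a"
      using q step by (intro cross_diff) auto
    with w[OF q] show "w q + cross q a b - (w q' + cross q' a b) = ray q q' b - ray q q' x0"
      by simp
  qed
qed

text \<open>A lattice version of Sperner's lemma: summing the circulation of \<open>h\<close> over all unit squares of the
  box leaves the circulation along the boundary of the box, which is a nonzero winding number.\<close>

lemma lattice_sperner: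
  fixes n :: nat and W :: "int \<times> int \<Rightarrow> int \<times> int \<Rightarrow> int" and h :: "int \<times> int \<Rightarrow> int \<times> int \<Rightarrow> int"
  defines "a \<equiv> \<lambda>x y q. W x q + cross q x y - W y q"
  assumes square: "\<And>i j :: nat. i < n \<Longrightarrow> j < n \<Longrightarrow> \<exists>q. q \<noteq> (int i, int j) \<and>
      h (int i, int j) (int i + 1, int j) = a (int i, int j) (int i + 1, int j) q \<and>
      h (int i, int j + 1) (int i + 1, int j + 1) = a (int i, int j + 1) (int i + 1, int j + 1) q \<and>
      h (int i, int j) (int i, int j + 1) = a (int i, int j) (int i, int j + 1) q \<and>
      h (int i + 1, int j) (int i + 1, int j + 1) = a (int i + 1, int j) (int i + 1, int j + 1) q"
    and q0: "0 \<le> fst q0" "fst q0 < int n" "0 \<le> snd q0" "snd q0 < int n"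
    and horizontal: "\<And>i j :: nat. i < n \<Longrightarrow> j \<in> {0, n} \<Longrightarrow>
      h (int i, int j) (int i + 1, int j) = a (int i, int j) (int i + 1, int j) q0"
    and vertical: "\<And>i j :: nat. i \<in> {0, n} \<Longrightarrow> j < n \<Longrightarrow>
      h (int i, int j) (int i, int j + 1) = a (int i, int j) (int i, int j + 1) q0"
  shows False
proof -
  define hR where "hR i j = h (int i, int j) (int i + 1, int j)" for i j :: nat
  define hU where "hU i j = h (int i, int j) (int i, int j + 1)" for i j :: nat
  define WH where "WH i = W (int i, 0) q0 - W (int i, int n) q0" for i :: nat
  define WV where "WV j = W (int n, int j) q0 - W (0, int j) q0" for j :: nat
  have s: "int (Suc k) = int k + 1" for k by simp
  \<comment> \<open>The \<open>W\<close> terms cancel around the square. What remains is the winding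
    number of its boundary around the centre belonging to \<open>q\<close>, which vanishes unless
    \<open>q\<close> is this very square.\<close>
  have zero: "(hR i j - hR i (Suc j)) + (hU (Suc i) j - hU i j) = 0" if "i < n" "j < n" for i j
  proof -
    from square[OF that] obtain q where q: "q \<noteq> (int i, int j)"
      "h (int i, int j) (int i + 1, int j) = a (int i, int j) (int i + 1, int j) q"
      "h (int i, int j + 1) (int i + 1, int j + 1) = a (int i, int j + 1) (int i + 1, int j + 1) q"
      "h (int i, int j) (int i, int j + 1) = a (int i, int j) (int i, int j + 1) q"
      "h (int i + 1, int j) (int i + 1, int j + 1) = a (int i + 1, int j) (int i + 1, int j + 1) q"
      by blast
    show ?thesis
      unfolding hR_def hU_def s q(2-5) a_def
      using q(1) by (cases q) (auto simp: cross_def)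
  qed
  have tel: "(\<Sum>k<m. f k - f (Suc k)) = f 0 - f m" for f :: "nat \<Rightarrow> int" and m
    by (induction m) auto
  have tel': "(\<Sum>k<m. f (Suc k) - f k) = f m - f 0" for f :: "nat \<Rightarrow> int" and m
    by (induction m) auto
  have "0 = (\<Sum>i<n. \<Sum>j<n. (hR i j - hR i (Suc j)) + (hU (Suc i) j - hU i j))"
    using zero by simp
  also have "\<dots> = (\<Sum>i<n. \<Sum>j<n. hR i j - hR i (Suc j)) + (\<Sum>i<n. \<Sum>j<n. hU (Suc i) j - hU i j)"
    by (simp only: sum.distrib)
  also have "(\<Sum>i<n. \<Sum>j<n. hU (Suc i) j - hU i j) = (\<Sum>j<n. \<Sum>i<n. hU (Suc i) j - hU i j)"
    by (rule sum.swap)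
  also have "\<dots> = (\<Sum>j<n. hU n j - hU 0 j)"
    by (intro sum.cong refl tel')
  also have "(\<Sum>i<n. \<Sum>j<n. hR i j - hR i (Suc j)) = (\<Sum>i<n. hR i 0 - hR i n)"
    by (intro sum.cong refl tel)
  \<comment> \<open>The ray of \<open>q0\<close> starts inside the box and goes up: it misses the
    bottom side and meets the top side in exactly one edge.\<close>
  also have "\<dots> = (\<Sum>i<n. (WH i - WH (Suc i)) - of_bool (int i = fst q0))"
  proof (intro sum.cong refl)
    fix i assume "i \<in> {..<n}"
    then have i: "i < n" by simp
    show "hR i 0 - hR i n = (WH i - WH (Suc i)) - of_bool (int i = fst q0)"
      unfolding hR_def WH_def s using horizontal[OF i, of 0] horizontal[OF i, of n] q0
      by (simp add: a_def cross_def algebra_simps)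
  qed
  also have "\<dots> = WH 0 - WH n - (\<Sum>i<n. of_bool (int i = fst q0))"
    by (simp only: sum_subtractf[of _ "\<lambda>i. of_bool (int i = fst q0)"] tel)
  also have "(\<Sum>j<n. hU n j - hU 0 j) = (\<Sum>j<n. WV j - WV (Suc j))"
  proof (intro sum.cong refl)
    fix j assume "j \<in> {..<n}"
    then have j: "j < n" by simp
    show "hU n j - hU 0 j = WV j - WV (Suc j)"
      unfolding hU_def WV_def s using vertical[OF _ j, of 0] vertical[OF _ j, of n]
      by (simp add: a_def cross_def algebra_simps)
  qed
  also have "\<dots> = WV 0 - WV n"
    by (rule tel)
  \<comment> \<open>The \<open>W\<close> values at the four corners of the box cancel, which leaves
    the single crossing with the top side.\<close>
  finally have "(\<Sum>i<n. of_bool (int i = fst q0)) = (0::int)" by (simp add: WH_def WV_def)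
  moreover have "(\<Sum>i<n. of_bool (int i = fst q0)) = (\<Sum>i<n. if i = nat (fst q0) then 1 else (0::int))"
    using q0 by (intro sum.cong) auto
  moreover have "\<dots> = 1" using q0 by (subst sum.delta) auto
  ultimately show False by simp
qed

section \<open>Separators from lattice models of graphs\<close>

definition uadj :: "'a set set \<Rightarrow> 'a \<Rightarrow> 'a \<Rightarrow> bool" where
  "uadj E u v \<longleftrightarrow> {u, v} \<in> E"

lemma symp_uadj: "symp (uadj E)"
  by (auto simp: symp_def uadj_def insert_commute)

section \<open>Walks in the lattice and along the boundary of a box\<close>

lemma linked_horizontal:
  assumes "a \<le> b" "\<And>k. a \<le> k \<Longrightarrow> k \<le> b \<Longrightarrow> (k, j) \<in> Z"
  shows "((a, j), (b, j)) \<in> linked gadj Z"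
  using assms
proof (induction b rule: int_ge_induct)
  case (step i)
  have "((i, j), (i + 1, j)) \<in> linked gadj Z"
    using step by (intro linked_edge) (auto simp: gadj_def)
  moreover have "((a, j), (i, j)) \<in> linked gadj Z"
    using step by auto
  ultimately show ?case by (rule linked_trans[rotated])
qed simp

lemma linked_vertical:
  assumes "a \<le> b" "\<And>k. a \<le> k \<Longrightarrow> k \<le> b \<Longrightarrow> (i, k) \<in> Z"
  shows "((i, a), (i, b)) \<in> linked gadj Z"
  using assms
proof (induction b rule: int_ge_induct)
  case (step j)
  have "((i, j), (i, j + 1)) \<in> linked gadj Z"
    using step by (intro linked_edge) (auto simp: gadj_def)
  moreover have "((i, a), (i, j)) \<in> linked gadj Z"
    using step by auto
  ultimately show ?case by (rule linked_trans[rotated])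
qed simp

lemma lattice_connected: "(x, y) \<in> linked gadj UNIV"
proof -
  obtain a b c d where xy: "x = (a, b)" "y = (c, d)" by (metis surj_pair)
  have "((a, b), (c, b)) \<in> linked gadj UNIV"
    using linked_horizontal[of a c b UNIV] linked_horizontal[of c a b UNIV] linked_sym[OF symp_gadj]
    by (cases "a \<le> c") auto
  moreover have "((c, b), (c, d)) \<in> linked gadj UNIV"
    using linked_vertical[of b d c UNIV] linked_vertical[of d b c UNIV] linked_sym[OF symp_gadj]
    by (cases "b \<le> d") auto
  ultimately show ?thesis unfolding xy by (rule linked_trans)
qed

definition frame :: "int \<Rightarrow> (int \<times> int) set" where
  "frame n = {x. fst x \<in> {0..n} \<and> snd x \<in> {0..n} \<and> (fst x \<in> {0, n} \<or> snd x \<in> {0, n})}"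

lemma frame_connected:
  assumes "x \<in> frame n" shows "((0, 0), x) \<in> linked gadj (frame n)"
proof -
  obtain i j where x: "x = (i, j)" by (metis surj_pair)
  have ij: "0 \<le> i" "i \<le> n" "0 \<le> j" "j \<le> n" "i = 0 \<or> i = n \<or> j = 0 \<or> j = n"
    using assms by (auto simp: frame_def x)
  have 1: "((0, 0), (0, j)) \<in> linked gadj (frame n)" "((n, 0), (n, j)) \<in> linked gadj (frame n)"
    using ij by (auto intro!: linked_vertical simp: frame_def)
  have 2: "((0, 0), (i, 0)) \<in> linked gadj (frame n)" "((0, n), (i, n)) \<in> linked gadj (frame n)"
    using ij by (auto intro!: linked_horizontal simp: frame_def)
  have 3: "((0, 0), (n, 0)) \<in> linked gadj (frame n)"
    using ij by (auto intro!: linked_horizontal simp: frame_def)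
  have 4: "((0, 0), (0, n)) \<in> linked gadj (frame n)"
    using ij by (auto intro!: linked_vertical simp: frame_def)
  show ?thesis
    using ij(5) linked_trans[OF 3 1(2)] linked_trans[OF 4 2(2)] 1(1) 2(1) unfolding x by auto
qed

text \<open>\<open>N\<close> maps a vertex \<open>{v}\<close> or an edge \<open>{u, v}\<close> of the graph to the lattice points near its drawing.\<close>

locale lattice_model =
  fixes V :: "'a set" and E :: "'a set set" and r :: 'a
    and N :: "'a set \<Rightarrow> (int \<times> int) set" and n :: nat
  assumes finite_V: "finite V" and r_in: "r \<in> V"
    and E_pairs: "e \<in> E \<Longrightarrow> \<exists>u\<in>V. \<exists>v\<in>V. e = {u, v}"
    and N_conn: "o1 \<in> (\<lambda>v. {v}) ` V \<union> E \<Longrightarrow> conn gadj (N o1)"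
    and N_ne: "v \<in> V \<Longrightarrow> N {v} \<noteq> {}"
    and N_mono: "e \<in> E \<Longrightarrow> v \<in> e \<Longrightarrow> N {v} \<subseteq> N e"
    and N_disj: "o1 \<in> (\<lambda>v. {v}) ` V \<union> E \<Longrightarrow> o2 \<in> (\<lambda>v. {v}) ` V \<union> E \<Longrightarrow> o1 \<inter> o2 = {} \<Longrightarrow> N o1 \<inter> N o2 = {}"
    and N_box: "o1 \<in> (\<lambda>v. {v}) ` V \<union> E \<Longrightarrow> N o1 \<subseteq> {0<..<int n} \<times> {0<..<int n}"
begin

text \<open>Vertices enter as singletons, so a loop is the same object as its vertex.\<close>

definition "objs = (\<lambda>v. {v}) ` V \<union> E"
definition "used = \<Union> (N ` objs)"
definition "zone X = \<Union> {N ob | ob. ob \<in> objs \<and> ob \<subseteq> X} \<union> - used"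
definition "x0 = (SOME x. x \<in> N {r})"

lemma objs_cases: "ob \<in> objs \<Longrightarrow> ob \<subseteq> V \<and> ob \<noteq> {} \<and> card ob \<le> 2"
  unfolding objs_def using E_pairs by (fastforce simp: card_insert_if)

lemma singleton_objs: "v \<in> V \<Longrightarrow> {v} \<in> objs"
  by (auto simp: objs_def)

lemma N_mono': "ob \<in> objs \<Longrightarrow> v \<in> ob \<Longrightarrow> N {v} \<subseteq> N ob"
  using N_mono by (auto simp: objs_def)

lemma x0: "x0 \<in> N {r}"
  unfolding x0_def using N_ne[OF r_in] by (simp add: some_in_eq)

lemma N_zone: "ob \<in> objs \<Longrightarrow> ob \<subseteq> X \<Longrightarrow> N ob \<subseteq> zone X"
  by (auto simp: zone_def)

lemma N_zone_disj:
  assumes "ob \<in> objs" "ob \<inter> X = {}" shows "N ob \<inter> zone X = {}"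
  using assms N_disj[folded objs_def, of ob] by (fastforce simp: zone_def used_def)

text \<open>A path of the graph in \<open>Y\<close> lifts to a lattice walk, since each
  \<open>N {a, b}\<close> is connected and contains both \<open>N {a}\<close> and
  \<open>N {b}\<close>.\<close>

lemma zone_singleton:
  assumes "(r, v) \<in> linked (uadj E) Y" "Y \<subseteq> X" "r \<in> Y" "q \<in> N {v}"
  shows "(x0, q) \<in> linked gadj (zone X)"
proof -
  have "\<forall>q\<in>N {v}. (x0, q) \<in> linked gadj (zone X)"
    using assms(1)
  proof (induction rule: linked_induct)
    case base
    have "N {r} \<subseteq> zone X"
      using assms by (intro N_zone singleton_objs r_in) auto
    then show ?case
      using linked_mono[OF connD[OF N_conn[folded objs_def, OF singleton_objs[OF r_in]] x0]] by blast
  next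
    case (step a b)
    have ab: "{a, b} \<in> objs" using step by (auto simp: objs_def uadj_def)
    have "a \<in> V" using objs_cases[OF ab] by auto
    then obtain q' where q': "q' \<in> N {a}" using N_ne by blast
    have sub: "N {a, b} \<subseteq> zone X" using step assms by (intro N_zone ab) auto
    show ?case
    proof
      fix q assume "q \<in> N {b}"
      then have "(q', q) \<in> linked gadj (N {a, b})"
        using q' N_mono'[OF ab, of a] N_mono'[OF ab, of b]
        by (intro connD N_conn[folded objs_def] ab) auto
      then show "(x0, q) \<in> linked gadj (zone X)"
        using step(5) q' linked_trans[OF _ linked_mono[OF _ sub]] by blast
    qed
  qed
  then show ?thesis using assms by blast
qed

end

text \<open>If deleting the at most eight sets \<open>P v\<close> belonging to the corners of a unit square always left a heavy
  connected set, then the winding numbers, around these heavy sets, of the closed walks through the lattice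
  edges would define a function \<open>h\<close> that contradicts \<open>lattice_sperner\<close>. The boundary of the box shares a
  single label, so that one heavy set serves all of its edges.\<close>

theorem (in lattice_model) lattice_separator:
  fixes P :: "'a \<Rightarrow> 'a set"
  assumes P: "\<And>v. v \<in> V \<Longrightarrow> P v \<subseteq> V" "\<And>v. v \<in> V \<Longrightarrow> r \<in> P v" "\<And>v. v \<in> V \<Longrightarrow> v \<in> P v"
    "\<And>v. v \<in> V \<Longrightarrow> conn (uadj E) (P v)"
    and S: "S \<subseteq> V"
  shows "\<exists>A. A \<subseteq> V \<and> A \<noteq> {} \<and> card A \<le> 8 \<and>
     (\<forall>K. K \<subseteq> V - \<Union> (P ` A) \<longrightarrow> conn (uadj E) K \<longrightarrow> 2 * card (K \<inter> S) \<le> card S)"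
proof (rule ccontr)
  assume contra: "\<not> ?thesis"
  \<comment> \<open>The region in which a lattice point with label \<open>ob\<close> is joined to
    \<open>x0\<close>.\<close>
  define Y where "Y ob = zone (\<Union> (P ` ob))" for ob
  define good where "good A K \<longleftrightarrow> K \<subseteq> V - \<Union> (P ` A) \<and> conn (uadj E) K \<and> card S < 2 * card (K \<inter> S)" for A K
  have finS: "finite S" using S finite_V finite_subset by auto
  have ex_good: "\<exists>K. good A K" if "A \<subseteq> V" "A \<noteq> {}" "card A \<le> 8" for A
    using contra that unfolding good_def by (meson not_le)
  \<comment> \<open>Each of the two sets contains more than half of \<open>S\<close>.\<close>
  have good_meet: "K1 \<inter> K2 \<noteq> {}" if "good A K1" "good B K2" for A B K1 K2
  proof
    assume "K1 \<inter> K2 = {}"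
    then have "card (K1 \<inter> S) + card (K2 \<inter> S) = card ((K1 \<inter> S) \<union> (K2 \<inter> S))"
      using finS by (subst card_Un_disjoint) auto
    also have "\<dots> \<le> card S" using finS by (intro card_mono) auto
    finally show False using that by (auto simp: good_def)
  qed
  have good_ne: "K \<noteq> {}" if "good A K" for A K
    using that by (auto simp: good_def)
  have Y_linked: "(x0, q) \<in> linked gadj (Y ob) \<and> q \<in> Y ob" if ob: "ob \<in> objs" "q \<in> N ob" for ob q
  proof -
    have V: "ob \<subseteq> V" "ob \<noteq> {}" using objs_cases[OF ob(1)] by auto
    then obtain v where v: "v \<in> ob" "v \<in> V" by auto
    then obtain q' where q': "q' \<in> N {v}" using N_ne by blast
    have 1: "(x0, q') \<in> linked gadj (Y ob)"
      unfolding Y_def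
      by (rule zone_singleton[where v = v and Y = "P v"])
        (use v q' P(2,3)[OF v(2)] connD[OF P(4)[OF v(2)]] in auto)
    have sub: "N ob \<subseteq> Y ob" unfolding Y_def
      using V P(3) by (intro N_zone ob) auto
    have "(q', q) \<in> linked gadj (N ob)"
      using q' ob N_mono'[OF ob(1) v(1)] by (intro connD N_conn[folded objs_def]) auto
    then show ?thesis using linked_trans[OF 1 linked_mono[OF _ sub]] sub ob by blast
  qed
  have label_ex: "\<exists>ob\<in>objs. (x0, x) \<in> linked gadj (Y ob) \<and> x \<in> Y ob" for x
    using lattice_connected[of x0 x]
  proof (induction rule: linked_induct)
    case base
    then show ?case using Y_linked[OF singleton_objs[OF r_in] x0] singleton_objs[OF r_in] by blast
  next
    case (step a b)
    show ?case
    proof (cases "b \<in> used")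
      case True
      then show ?thesis using Y_linked unfolding used_def by blast
    next
      case False
      from step obtain ob where ob: "ob \<in> objs" "(x0, a) \<in> linked gadj (Y ob)" "a \<in> Y ob" by blast
      have "b \<in> Y ob" using False by (auto simp: Y_def zone_def)
      then show ?thesis using ob(1) linked_trans[OF ob(2) linked_edge[of a _ b gadj, OF ob(3) _ step(4)]] by blast
    qed
  qed
  then obtain o0 where o0: "o0 \<in> objs" "(x0, (0, 0)) \<in> linked gadj (Y o0)" "(0, 0) \<in> Y o0"
    by blast
  have frame_unused: "frame (int n) \<subseteq> - used"
    using N_box[folded objs_def] by (fastforce simp: used_def frame_def)
  then have frame_Y: "frame (int n) \<subseteq> Y o0" by (auto simp: Y_def zone_def)
  have "\<exists>ob\<in>objs. (x0, x) \<in> linked gadj (Y ob) \<and> x \<in> Y ob \<and> (x \<in> frame (int n) \<longrightarrow> ob = o0)" for x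
  proof (cases "x \<in> frame (int n)")
    case True
    have "((0, 0), x) \<in> linked gadj (Y o0)"
      using frame_connected[OF True] frame_Y by (rule linked_mono)
    then show ?thesis using o0(1) linked_trans[OF o0(2)] frame_Y True by blast
  qed (use label_ex in blast)
  then obtain lb where lb: "\<And>x. lb x \<in> objs" "\<And>x. (x0, x) \<in> linked gadj (Y (lb x))"
    "\<And>x. x \<in> Y (lb x)" "\<And>x. x \<in> frame (int n) \<Longrightarrow> lb x = o0" by metis
  have "\<forall>x. \<exists>w :: int \<times> int \<Rightarrow> int. \<forall>q q'. gadj q q' \<longrightarrow> q \<notin> Y (lb x) \<longrightarrow> q' \<notin> Y (lb x) \<longrightarrow>
           w q - w q' = ray q q' x - ray q q' x0"
    using lattice_chain lb(2) by blast
  then obtain W :: "int \<times> int \<Rightarrow> int \<times> int \<Rightarrow> int" where W: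
    "\<And>x q q'. gadj q q' \<Longrightarrow> q \<notin> Y (lb x) \<Longrightarrow> q' \<notin> Y (lb x) \<Longrightarrow>
           W x q - W x q' = ray q q' x - ray q q' x0" by metis
  \<comment> \<open>The winding number around \<open>q\<close> of the closed walk from
    \<open>x0\<close> to \<open>x\<close>, on to \<open>y\<close> and back, up to the constants that
    the jumps of \<open>W\<close> leave open.\<close>
  define a where "a x y q = W x q + cross q x y - W y q" for x y q
  \<comment> \<open>When \<open>q\<close> moves by one step, the ray values at \<open>x0\<close>,
    \<open>x\<close> and \<open>y\<close> each occur twice with opposite signs.\<close>
  have a_linked: "a x y q = a x y q'"
    if "gadj x y" "(q, q') \<in> linked gadj M" "M \<inter> (Y (lb x) \<union> Y (lb y)) = {}" for x y q q' M
    using that(2)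
  proof (induction rule: linked_induct)
    case (step b c)
    have *: "b \<notin> Y (lb x)" "b \<notin> Y (lb y)" "c \<notin> Y (lb x)" "c \<notin> Y (lb y)" using step that(3) by auto
    have "cross b x y - cross c x y = ray b c y - ray b c x"
      using * lb(3)[of x] lb(3)[of y] step(4) that(1) by (intro cross_diff) auto
    moreover note W[OF step(4), of x] W[OF step(4), of y]
    ultimately show ?case using step * by (simp add: a_def)
  qed simp
  have avoid: "N ob \<inter> (Y (lb x) \<union> Y (lb y)) = {}"
    if "ob \<in> objs" "ob \<subseteq> K" "K \<subseteq> V - \<Union> (P ` (lb x \<union> lb y))" for ob x y K
  proof -
    have "N ob \<inter> Y (lb x) = {}" "N ob \<inter> Y (lb y) = {}"
      unfolding Y_def by (intro N_zone_disj that; use that in blast)+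
    then show ?thesis by blast
  qed
  \<comment> \<open>A path in \<open>K\<close> lifts to the lattice, and \<open>avoid\<close> keeps
    the lift off the regions of both labels.\<close>
  have a_const: "a x y q1 = a x y q2"
    if xy: "gadj x y" and K: "K \<subseteq> V - \<Union> (P ` (lb x \<union> lb y))" "conn (uadj E) K"
      and v: "v1 \<in> K" "v2 \<in> K" and q: "q1 \<in> N {v1}" "q2 \<in> N {v2}" for x y q1 q2 K v1 v2
  proof -
    have "\<forall>q\<in>N {v2}. a x y q1 = a x y q"
      using connD[OF K(2) v]
    proof (induction rule: linked_induct)
      case base
      have ob: "{v1} \<in> objs" using K v by (intro singleton_objs) auto
      have "N {v1} \<inter> (Y (lb x) \<union> Y (lb y)) = {}" using ob v by (intro avoid[OF _ _ K(1)]) auto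
      then show ?case
        using a_linked[OF xy _ \<open>N {v1} \<inter> _ = {}\<close>] connD[OF N_conn[folded objs_def, OF ob]] q by blast
    next
      case (step b c)
      have ob: "{b, c} \<in> objs" using step by (auto simp: objs_def uadj_def)
      have av: "N {b, c} \<inter> (Y (lb x) \<union> Y (lb y)) = {}"
        using ob step by (intro avoid[OF _ _ K(1)]) auto
      obtain q' where q': "q' \<in> N {b}" using N_ne K step by blast
      show ?case
      proof
        fix q assume "q \<in> N {c}"
        then have "(q', q) \<in> linked gadj (N {b, c})"
          using q' N_mono'[OF ob, of b] N_mono'[OF ob, of c]
          by (intro connD N_conn[folded objs_def] ob) auto
        then show "a x y q1 = a x y q"
          using a_linked[OF xy _ av] step(5) q' by auto
      qed
    qed
    then show ?thesis using q by blast
  qed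
  \<comment> \<open>The winding number around any heavy set that avoids the walks of both labels.
    Two such sets meet, so the choice among them does not matter.\<close>
  define h where "h x y = (SOME t. \<exists>K v q. good (lb x \<union> lb y) K \<and> v \<in> K \<and> q \<in> N {v} \<and> t = a x y q)" for x y
  \<comment> \<open>A set that is good for a larger \<open>A\<close> yields the same value, so one
    heavy set can serve several edges at once.\<close>
  have h: "h x y = a x y q"
    if xy: "gadj x y" and A: "lb x \<union> lb y \<subseteq> A" and K: "good A K" "v \<in> K" "q \<in> N {v}" for x y A K v q
    unfolding h_def
  proof (rule some_equality)
    have gK: "good (lb x \<union> lb y) K" using K(1) A unfolding good_def by blast
    then show "\<exists>K v qa. good (lb x \<union> lb y) K \<and> v \<in> K \<and> qa \<in> N {v} \<and> a x y q = a x y qa"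
      using K by blast
    fix t assume "\<exists>K v q. good (lb x \<union> lb y) K \<and> v \<in> K \<and> q \<in> N {v} \<and> t = a x y q"
    then obtain K' v' q' where K': "good (lb x \<union> lb y) K'" "v' \<in> K'" "q' \<in> N {v'}" "t = a x y q'"
      by blast
    obtain u where u: "u \<in> K" "u \<in> K'" using good_meet[OF gK K'(1)] by blast
    then obtain q'' where q'': "q'' \<in> N {u}" using N_ne gK unfolding good_def by blast
    have "a x y q = a x y q''"
      using gK K u q'' unfolding good_def by (intro a_const[OF xy, of K v u]) auto
    moreover have "a x y q' = a x y q''"
      using K' u q'' unfolding good_def by (intro a_const[OF xy, of K' v' u]) auto
    ultimately show "t = a x y q" using K' by simp
  qed
  have point: "\<exists>v q. v \<in> K \<and> q \<in> N {v} \<and> q \<notin> Y ob" if K: "good A K" "ob \<subseteq> A" for A K ob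
  proof -
    obtain v where v: "v \<in> K" using good_ne[OF K(1)] by blast
    then have vV: "v \<in> V" "v \<notin> \<Union> (P ` ob)" using K unfolding good_def by blast+
    then obtain q where "q \<in> N {v}" using N_ne by blast
    moreover have "N {v} \<inter> Y ob = {}"
      unfolding Y_def using vV by (intro N_zone_disj singleton_objs) auto
    ultimately show ?thesis using v by blast
  qed
  have obV: "ob \<subseteq> V" "ob \<noteq> {}" "card ob \<le> 2" if "ob \<in> objs" for ob
    using objs_cases[OF that] by auto
  \<comment> \<open>All frame edges carry the label \<open>o0\<close>, so \<open>K0\<close> and the
    point \<open>q0\<close> near it serve the whole boundary.\<close>
  have "\<exists>K. good o0 K"
    using obV[OF o0(1)] by (intro ex_good) auto
  then obtain K0 where K0: "good o0 K0" by blast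
  obtain v0 q0 where q0: "v0 \<in> K0" "q0 \<in> N {v0}" using point[OF K0 order_refl] by blast
  have "v0 \<in> V" using K0 q0 by (auto simp: good_def)
  then have q0_box: "q0 \<in> {0<..<int n} \<times> {0<..<int n}"
    using N_box[folded objs_def, OF singleton_objs] q0 by blast
  show False
  proof (rule lattice_sperner[where n = n and W = W and h = h and ?q0.0 = q0, folded a_def])
    fix i j assume ij: "i < n" "j < n"
    let ?o1 = "lb (int i, int j)" and ?o2 = "lb (int i + 1, int j)"
      and ?o3 = "lb (int i, int j + 1)" and ?o4 = "lb (int i + 1, int j + 1)"
    \<comment> \<open>Four corner labels of at most two vertices each give the bound 8. The point
      \<open>q\<close> chosen below lies outside the region of the lower left corner's label and
      hence differs from that corner.\<close>
    let ?A = "?o1 \<union> ?o2 \<union> (?o3 \<union> ?o4)"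
    have "card ?A \<le> (card ?o1 + card ?o2) + (card ?o3 + card ?o4)"
      by (meson add_mono card_Un_le order_trans)
    also have "\<dots> \<le> 8" using obV(3)[OF lb(1)] by (smt (verit) add_mono numeral_Bit0)
    finally have "\<exists>K. good ?A K"
      using obV(1,2)[OF lb(1)] by (intro ex_good) auto
    then obtain K where K: "good ?A K" by blast
    obtain v q where q: "v \<in> K" "q \<in> N {v}" "q \<notin> Y ?o1" using point[OF K, of ?o1] by blast
    show "\<exists>q. q \<noteq> (int i, int j) \<and>
      h (int i, int j) (int i + 1, int j) = a (int i, int j) (int i + 1, int j) q \<and>
      h (int i, int j + 1) (int i + 1, int j + 1) = a (int i, int j + 1) (int i + 1, int j + 1) q \<and>
      h (int i, int j) (int i, int j + 1) = a (int i, int j) (int i, int j + 1) q \<and>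
      h (int i + 1, int j) (int i + 1, int j + 1) = a (int i + 1, int j) (int i + 1, int j + 1) q"
      using q(3) lb(3)[of "(int i, int j)"] by (intro exI[of _ q] conjI h[OF _ _ K q(1,2)]) (auto simp: gadj_def)
  next
    fix i j :: nat assume ij: "i < n" "j \<in> {0, n}"
    have "(int i, int j) \<in> frame (int n)" "(int i + 1, int j) \<in> frame (int n)"
      using ij by (auto simp: frame_def)
    then show "h (int i, int j) (int i + 1, int j) = a (int i, int j) (int i + 1, int j) q0"
      using lb(4) by (intro h[OF _ _ K0 q0]) (auto simp: gadj_def)
  next
    fix i j :: nat assume ij: "i \<in> {0, n}" "j < n"
    have "(int i, int j) \<in> frame (int n)" "(int i, int j + 1) \<in> frame (int n)"
      using ij by (auto simp: frame_def)
    then show "h (int i, int j) (int i, int j + 1) = a (int i, int j) (int i, int j + 1) q0"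
      using lb(4) by (intro h[OF _ _ K0 q0]) (auto simp: gadj_def)
  qed (use q0_box in auto)
qed

section \<open>Planar drawings have lattice models\<close>

text \<open>The lattice points whose open box of side 2 meets the image of \<open>X\<close> under
  scaling by \<open>m\<close> and shifting by \<open>s\<close>. The boxes overlap and cover the
  plane, so connectedness survives the discretization.\<close>

definition near :: "real \<Rightarrow> real \<Rightarrow> complex set \<Rightarrow> (int \<times> int) set" where
  "near m s X = {(i, j). \<exists>z\<in>X. \<bar>m * Re z + s - of_int i\<bar> < 1 \<and> \<bar>m * Im z + s - of_int j\<bar> < 1}"

lemma near_mono: "X \<subseteq> Y \<Longrightarrow> near m s X \<subseteq> near m s Y"
  by (auto simp: near_def)

lemma near_nonempty:
  assumes "z \<in> X" shows "near m s X \<noteq> {}"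
proof -
  have "\<bar>m * Re z + s - of_int \<lfloor>m * Re z + s\<rfloor>\<bar> < 1" "\<bar>m * Im z + s - of_int \<lfloor>m * Im z + s\<rfloor>\<bar> < 1"
    by linarith+
  then have "(\<lfloor>m * Re z + s\<rfloor>, \<lfloor>m * Im z + s\<rfloor>) \<in> near m s X"
    using assms unfolding near_def mem_Collect_eq case_prod_conv by blast
  then show ?thesis by blast
qed

text \<open>If the lattice points fell into two unlinked parts, the open boxes around them would
  split \<open>X\<close> into two disjoint nonempty relatively open pieces.\<close>

lemma conn_near:
  assumes "topological_space_class.connected X" shows "conn gadj (near m s X)"
proof -
  define Ob where "Ob a = {z. \<bar>m * Re z + s - of_int (fst a)\<bar> < 1 \<and> \<bar>m * Im z + s - of_int (snd a)\<bar> < 1}"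
    for a :: "int \<times> int"
  have N: "near m s X = {a. X \<inter> Ob a \<noteq> {}}"
    by (auto simp: near_def Ob_def)
  have opn: "open (Ob a)" for a
    unfolding Ob_def by (intro open_Collect_conj open_Collect_less continuous_intros)
  show ?thesis unfolding conn_def
  proof (intro ballI)
    fix x y assume x: "x \<in> near m s X" and y: "y \<in> near m s X"
    define K where "K = {y \<in> near m s X. (x, y) \<in> linked gadj (near m s X)}"
    let ?A = "\<Union>a\<in>K. Ob a" and ?B = "\<Union>a\<in>near m s X - K. Ob a"
    have "z \<in> ?A \<union> ?B" if "z \<in> X" for z
    proof -
      have "z \<in> Ob (\<lfloor>m * Re z + s\<rfloor>, \<lfloor>m * Im z + s\<rfloor>)"
        unfolding Ob_def mem_Collect_eq fst_conv snd_conv by linarith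
      then show ?thesis using that N by blast
    qed
    then have cover: "X \<subseteq> ?A \<union> ?B" by blast
    have "z \<notin> ?B" if z: "z \<in> X" "z \<in> ?A" for z
    proof
      assume "z \<in> ?B"
      then obtain b where b: "b \<in> near m s X" "b \<notin> K" "z \<in> Ob b" by blast
      from z obtain a where a: "a \<in> K" "z \<in> Ob a" by blast
      \<comment> \<open>Boxes with a common point have centres that differ by at most 1 in each
        coordinate. The box around the mixed centre contains the point too, so unit steps through it
        link them.\<close>
      define c where "c = (fst a, snd b)"
      have c: "z \<in> Ob c" using a b by (auto simp: Ob_def c_def)
      have "a = c \<or> gadj a c"
        using a(2) c unfolding Ob_def c_def gadj_def by (cases a, cases b) auto
      moreover have "c = b \<or> gadj c b"
        using b(3) c unfolding Ob_def c_def gadj_def by (cases a, cases b) auto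
      moreover have aN: "a \<in> near m s X" "(x, a) \<in> linked gadj (near m s X)" using a by (auto simp: K_def)
      moreover have cN: "c \<in> near m s X" using c z N by blast
      ultimately have "(x, c) \<in> linked gadj (near m s X)"
        using linked_trans[OF aN(2) linked_edge[OF aN(1) cN]] by blast
      then have "(x, b) \<in> linked gadj (near m s X)"
        using \<open>c = b \<or> gadj c b\<close> linked_trans[OF _ linked_edge[OF cN b(1)]] by blast
      then show False using b by (auto simp: K_def)
    qed
    then have "?A \<inter> ?B \<inter> X = {}" by blast
    with cover assms have "?A \<inter> X = {} \<or> ?B \<inter> X = {}"
      by (intro connectedD) (auto intro: opn)
    moreover have "x \<in> K" using x by (auto simp: K_def)
    then have "?A \<inter> X \<noteq> {}" using x N by blast
    ultimately have "?B \<inter> X = {}" by blast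
    then have "y \<in> K" using y N by blast
    then show "(x, y) \<in> linked gadj (near m s X)" by (auto simp: K_def)
  qed
qed

text \<open>Points near the same lattice point differ by less than 2 in each scaled coordinate, so
  their scaled distance is less than 4.\<close>

lemma near_disjoint:
  assumes "\<And>x y. x \<in> X \<Longrightarrow> y \<in> Y \<Longrightarrow> d \<le> dist x y" "0 < m" "4 \<le> m * d"
  shows "near m s X \<inter> near m s Y = {}"
proof (rule ccontr)
  assume "near m s X \<inter> near m s Y \<noteq> {}"
  then obtain i j x y where xy: "x \<in> X" "y \<in> Y"
    "\<bar>m * Re x + s - of_int i\<bar> < 1" "\<bar>m * Im x + s - of_int j\<bar> < 1"
    "\<bar>m * Re y + s - of_int i\<bar> < 1" "\<bar>m * Im y + s - of_int j\<bar> < 1"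
    by (auto simp: near_def)
  have "\<bar>m * Re x - m * Re y\<bar> < 2" "\<bar>m * Im x - m * Im y\<bar> < 2" using xy by linarith+
  then have "m * \<bar>Re (x - y)\<bar> < 2" "m * \<bar>Im (x - y)\<bar> < 2"
    using assms(2) by (simp_all add: right_diff_distrib[symmetric] abs_mult)
  moreover have "m * dist x y \<le> m * (\<bar>Re (x - y)\<bar> + \<bar>Im (x - y)\<bar>)"
    using assms(2) cmod_le[of "x - y"] by (simp add: dist_norm)
  moreover have "m * d \<le> m * dist x y" using assms xy by simp
  ultimately show False using assms(3) by (simp add: distrib_left)
qed

text \<open>Objects without a common vertex have disjoint compact drawings. There are finitely many,
  so their distances have a positive lower bound, and a fine enough lattice keeps them
  apart.\<close>

theorem planar_lattice_model:
  assumes pl: "planar_drawing V E p g" and fin: "finite V'" "V' \<subseteq> V" and r: "r \<in> V'"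
    and E: "E' \<subseteq> E" "\<And>e. e \<in> E' \<Longrightarrow> \<exists>u\<in>V'. \<exists>v\<in>V'. e = {u, v}"
  shows "\<exists>N n. lattice_model V' E' r N n"
proof -
  \<comment> \<open>A loop at \<open>v\<close> is represented by the point of \<open>v\<close>
    alone.\<close>
  define X where "X ob = (if \<exists>v. ob = {v} then p ` ob else path_image (g ob))" for ob
  define obs where "obs = (\<lambda>v. {v}) ` V' \<union> E'"
  have inj: "inj_on p V" and ed: "\<And>e. e \<in> E \<Longrightarrow> simple_path (g e)"
    "\<And>e. e \<in> E \<Longrightarrow> {pathstart (g e), pathfinish (g e)} = p ` e"
    "\<And>e. e \<in> E \<Longrightarrow> path_image (g e) \<inter> p ` V = p ` e"
    and cr: "\<And>e f. e \<in> E \<Longrightarrow> f \<in> E \<Longrightarrow> e \<noteq> f \<Longrightarrow> path_image (g e) \<inter> path_image (g f) \<subseteq> p ` V"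
    using pl unfolding planar_drawing_def by blast+
  have "obs \<subseteq> Pow V'" using E by (fastforce simp: obs_def)
  then have fin_obs: "finite obs" using fin finite_subset by blast
  have obsE: "ob \<in> E" if "ob \<in> obs" "\<nexists>v. ob = {v}" for ob
    using that E by (auto simp: obs_def)
  have cpt: "compact (X ob)" if "ob \<in> obs" for ob
    using obsE[OF that] ed(1) by (auto simp: X_def intro!: compact_simple_path_image)
  have con: "topological_space_class.connected (X ob)" if "ob \<in> obs" for ob
    using obsE[OF that] ed(1) by (auto simp: X_def intro!: connected_simple_path_image)
  have XV: "X ob \<inter> p ` V = p ` ob" if "ob \<in> obs" for ob
  proof -
    have "ob \<subseteq> V" using that \<open>obs \<subseteq> Pow V'\<close> fin by blast
    then show ?thesis using obsE[OF that] ed(3) by (auto simp: X_def)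
  qed
  \<comment> \<open>A common point would be the image of a vertex; by \<open>XV\<close> and
    injectivity of \<open>p\<close> that vertex would belong to both objects.\<close>
  have disj: "X a \<inter> X b = {}" if ab: "a \<in> obs" "b \<in> obs" "a \<inter> b = {}" for a b
  proof (rule ccontr)
    assume "X a \<inter> X b \<noteq> {}"
    then obtain z where z: "z \<in> X a" "z \<in> X b" by blast
    have sub: "a \<subseteq> V" "b \<subseteq> V" using ab \<open>obs \<subseteq> Pow V'\<close> fin by auto
    have "z \<in> p ` V"
    proof (cases "(\<exists>v. a = {v}) \<or> (\<exists>v. b = {v})")
      case True
      then show ?thesis using z sub by (auto simp: X_def)
    next
      case False
      moreover have "a \<noteq> {}" using ab E by (auto simp: obs_def)
      ultimately show ?thesis using z cr[of a b] obsE ab by (auto simp: X_def)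
    qed
    then have "z \<in> p ` a" "z \<in> p ` b" using XV z ab by blast+
    then show False using inj_on_image_Int[OF inj sub] ab(3) by auto
  qed
  have "\<forall>a b. \<exists>d>0. a \<in> obs \<and> b \<in> obs \<and> a \<inter> b = {} \<longrightarrow> (\<forall>x\<in>X a. \<forall>y\<in>X b. d \<le> dist x y)"
  proof (intro allI)
    fix a b
    show "\<exists>d>0. a \<in> obs \<and> b \<in> obs \<and> a \<inter> b = {} \<longrightarrow> (\<forall>x\<in>X a. \<forall>y\<in>X b. d \<le> dist x y)"
      using separate_compact_closed[of "X a" "X b"] cpt[of a] compact_imp_closed[OF cpt[of b]] disj[of a b]
      by (cases "a \<in> obs \<and> b \<in> obs \<and> a \<inter> b = {}") (auto intro: exI[of _ 1])
  qed
  then obtain D where D: "\<And>a b. 0 < D a b"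
    "\<And>a b x y. a \<in> obs \<Longrightarrow> b \<in> obs \<Longrightarrow> a \<inter> b = {} \<Longrightarrow> x \<in> X a \<Longrightarrow> y \<in> X b \<Longrightarrow> (D a b :: real) \<le> dist x y"
    by metis
  define d where "d = Min ((\<lambda>(a, b). D a b) ` (obs \<times> obs))"
  have obs_ne: "obs \<noteq> {}" using r by (auto simp: obs_def)
  have finD: "finite ((\<lambda>(a, b). D a b) ` (obs \<times> obs))"
    by (intro finite_imageI finite_cartesian_product fin_obs)
  have d: "0 < d" using finD obs_ne D(1) unfolding d_def by (subst Min_gr_iff) auto
  have dD: "d \<le> D a b" if "a \<in> obs" "b \<in> obs" for a b
    unfolding d_def using that by (intro Min_le finD) auto
  define m where "m = 4 / d"
  have m: "0 < m" "4 \<le> m * d" using d by (auto simp: m_def)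
  have "bounded (\<Union> (X ` obs))"
    using fin_obs cpt by (auto intro!: compact_imp_bounded)
  then obtain B where B: "\<And>z. z \<in> \<Union> (X ` obs) \<Longrightarrow> cmod z \<le> B" "0 < B"
    by (metis bounded_pos)
  \<comment> \<open>Scaled coordinates lie between \<open>-c\<close> and \<open>c\<close>. The shift
    by \<open>c + 1\<close> and the box radius 1 put all lattice indices strictly between 0 and
    \<open>2 * c + 3\<close>.\<close>
  define c where "c = m * B"
  define s where "s = c + 1"
  define n where "n = nat \<lceil>2 * c + 3\<rceil>"
  have box: "near m s (X ob) \<subseteq> {0<..<int n} \<times> {0<..<int n}" if "ob \<in> obs" for ob
  proof
    fix x assume "x \<in> near m s (X ob)"
    then obtain i j z where z: "x = (i, j)" "z \<in> X ob"
      "\<bar>m * Re z + s - of_int i\<bar> < 1" "\<bar>m * Im z + s - of_int j\<bar> < 1" by (auto simp: near_def)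
    have "cmod z \<le> B" using B that z by blast
    then have "m * \<bar>Re z\<bar> \<le> m * B" "m * \<bar>Im z\<bar> \<le> m * B"
      using m abs_Re_le_cmod[of z] abs_Im_le_cmod[of z] by (auto intro!: mult_left_mono)
    then have "\<bar>m * Re z\<bar> \<le> c" "\<bar>m * Im z\<bar> \<le> c" using m by (auto simp: abs_mult c_def)
    moreover have "0 < t \<and> t < 2 * c + 3" if "\<bar>y\<bar> \<le> c" "\<bar>y + s - t\<bar> < 1" for y t
      using that unfolding s_def by arith
    ultimately have "0 < real_of_int i" "real_of_int i < 2 * c + 3" "0 < real_of_int j" "real_of_int j < 2 * c + 3"
      using z(3,4) by blast+
    then show "x \<in> {0<..<int n} \<times> {0<..<int n}"
      using z(1) unfolding n_def by (auto; linarith)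
  qed
  have "lattice_model V' E' r (\<lambda>ob. near m s (X ob)) n"
  proof
    show "near m s (X o1) \<inter> near m s (X o2) = {}"
      if "o1 \<in> (\<lambda>v. {v}) ` V' \<union> E'" "o2 \<in> (\<lambda>v. {v}) ` V' \<union> E'" "o1 \<inter> o2 = {}" for o1 o2
    proof (rule near_disjoint[OF _ m])
      fix x y assume "x \<in> X o1" "y \<in> X o2"
      then show "d \<le> dist x y" using D(2)[of o1 o2 x y] dD[of o1 o2] that by (auto simp: obs_def)
    qed
    show "near m s (X {v}) \<subseteq> near m s (X e)" if "e \<in> E'" "v \<in> e" for e v
    proof (rule near_mono)
      have "e \<in> obs" using that by (auto simp: obs_def)
      then show "X {v} \<subseteq> X e" using XV[of e] that by (auto simp: X_def)
    qed
    show "near m s (X {v}) \<noteq> {}" for v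
      by (rule near_nonempty[of "p v"]) (auto simp: X_def)
  qed (use fin r E conn_near con box in \<open>auto simp: obs_def\<close>)
  then show ?thesis by blast
qed

lemma linked_uadj_restrict:
  "Z \<subseteq> V' \<Longrightarrow> linked (uadj {e \<in> E. e \<subseteq> V'}) Z = linked (uadj E) Z"
  unfolding linked_def by (rule arg_cong[where f = rtrancl]) (auto simp: uadj_def)

text \<open>The drawing of the whole graph also serves the subgraph induced on \<open>V'\<close>,
  and subsets of \<open>V'\<close> are connected in one exactly if they are in the other.\<close>

theorem planar_separator:
  assumes pl: "planar_graph V E" and E: "\<And>e. e \<in> E \<Longrightarrow> \<exists>u v. e = {u, v}"
    and V': "finite V'" "V' \<subseteq> V" and r: "r \<in> V'" and S: "S \<subseteq> V'"
    and P: "\<And>v. v \<in> V' \<Longrightarrow> P v \<subseteq> V'" "\<And>v. v \<in> V' \<Longrightarrow> r \<in> P v" "\<And>v. v \<in> V' \<Longrightarrow> v \<in> P v"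
    "\<And>v. v \<in> V' \<Longrightarrow> conn (uadj E) (P v)"
  shows "\<exists>A. A \<subseteq> V' \<and> A \<noteq> {} \<and> card A \<le> 8 \<and>
     (\<forall>K. K \<subseteq> V' - \<Union> (P ` A) \<longrightarrow> conn (uadj E) K \<longrightarrow> 2 * card (K \<inter> S) \<le> card S)"
proof -
  obtain p g where pg: "planar_drawing V E p g" using pl by (auto simp: planar_graph_def)
  obtain N n where "lattice_model V' {e \<in> E. e \<subseteq> V'} r N n"
    using planar_lattice_model[OF pg V' r, of "{e \<in> E. e \<subseteq> V'}"] E by fastforce
  then interpret lattice_model V' "{e \<in> E. e \<subseteq> V'}" r N n .
  have eq: "conn (uadj {e \<in> E. e \<subseteq> V'}) Z = conn (uadj E) Z" if "Z \<subseteq> V'" for Z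
    using linked_uadj_restrict[OF that] by (simp add: conn_def)
  have P': "conn (uadj {e \<in> E. e \<subseteq> V'}) (P v)" if "v \<in> V'" for v
    using eq[OF P(1)[OF that]] P(4)[OF that] by simp
  obtain A where A: "A \<subseteq> V'" "A \<noteq> {}" "card A \<le> 8"
    "\<And>K. K \<subseteq> V' - \<Union> (P ` A) \<Longrightarrow> conn (uadj {e \<in> E. e \<subseteq> V'}) K \<Longrightarrow> 2 * card (K \<inter> S) \<le> card S"
    using lattice_separator[OF P(1-3) P' S] by auto
  have "2 * card (K \<inter> S) \<le> card S" if "K \<subseteq> V' - \<Union> (P ` A)" "conn (uadj E) K" for K
  proof -
    have "K \<subseteq> V'" using that by blast
    then show ?thesis using A(4)[OF that(1)] that(2) eq by blast
  qed
  then show ?thesis using A(1-3) by blast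
qed

section \<open>Truncating fractional solutions to a ball\<close>

text \<open>The length \<open>t\<close> counts repeated arcs with multiplicity, whereas
  \<open>F\<close> is the set of arcs used; for nonnegative costs \<open>t\<close> bounds the price
  of buying \<open>F\<close>.\<close>

inductive dwalk for A :: "('a \<times> 'a) set" and c :: "'a \<times> 'a \<Rightarrow> real" and X C :: "'a set" where
  start: "v \<in> X \<Longrightarrow> dwalk A c X C v 0 {}"
| step: "dwalk A c X C u t F \<Longrightarrow> (u, v) \<in> A \<Longrightarrow> v \<in> C \<Longrightarrow> dwalk A c X C v (t + c (u, v)) (insert (u, v) F)"

lemma dwalk_arcs:
  assumes "dwalk A c X C v t F" shows "finite F" "F \<subseteq> A" "snd ` F \<subseteq> C" "v \<in> X \<union> snd ` F"
  using assms by (induction rule: dwalk.induct) auto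

lemma dwalk_cost:
  assumes "dwalk A c X C v t F" "\<And>e. e \<in> A \<Longrightarrow> 0 \<le> c e" shows "0 \<le> t" "sum c F \<le> t"
proof -
  have "0 \<le> t \<and> sum c F \<le> t"
    using assms(1)
  proof (induction rule: dwalk.induct)
    case (step u t F v)
    then have "finite F" "0 \<le> c (u, v)" using dwalk_arcs(1) assms(2) by auto
    then show ?case using step by (simp add: sum.insert_if)
  qed simp
  then show "0 \<le> t" "sum c F \<le> t" by auto
qed

text \<open>Cutting the walk off at \<open>w\<close> cannot make it longer. Hence a walk shorter
  than the radius of a ball stays inside the ball.\<close>

lemma dwalk_prefix:
  assumes "dwalk A c X C v t F" "\<And>e. e \<in> A \<Longrightarrow> 0 \<le> c e" "w \<in> snd ` F"
  shows "\<exists>t' F'. t' \<le> t \<and> dwalk A c X C w t' F'"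
  using assms(1,3)
proof (induction rule: dwalk.induct)
  case (step u t F v)
  show ?case
  proof (cases "w = v")
    case True
    then show ?thesis using dwalk.step[OF step(1-3)] by blast
  next
    case False
    then obtain t' F' where "t' \<le> t" "dwalk A c X C w t' F'" using step by auto
    then show ?thesis using assms(2)[OF step(2)] by (intro exI[of _ t'] exI[of _ F']) auto
  qed
qed simp

lemma dwalk_reach:
  assumes "dwalk A c X C v t F" "w \<in> X \<union> snd ` F"
  shows "\<exists>a\<in>X. (a, w) \<in> F\<^sup>*"
  using assms
proof (induction arbitrary: w rule: dwalk.induct)
  case (step u t F v)
  have mono: "F\<^sup>* \<subseteq> (insert (u, v) F)\<^sup>*" by (intro rtrancl_mono) auto
  show ?case
  proof (cases "w \<in> X \<union> snd ` F")
    case True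
    then show ?thesis using step.IH mono by blast
  next
    case False
    then have "w = v" using step.prems by auto
    obtain a where "a \<in> X" "(a, u) \<in> F\<^sup>*" using step.IH dwalk_arcs(4)[OF step(1)] by blast
    then have "(a, v) \<in> (insert (u, v) F)\<^sup>*" using mono by (meson insertI1 rtrancl.rtrancl_into_rtrancl subsetD)
    then show ?thesis using \<open>a \<in> X\<close> \<open>w = v\<close> by blast
  qed
qed auto

lemma dwalk_conn:
  assumes "dwalk A c X C v t F" "\<And>u v. (u, v) \<in> A \<Longrightarrow> {u, v} \<in> E" "r \<in> X" "conn (uadj E) X"
  shows "conn (uadj E) (X \<union> snd ` F)"
proof -
  have "\<forall>w\<in>X \<union> snd ` F. (r, w) \<in> linked (uadj E) (X \<union> snd ` F)"
    using assms(1)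
  proof (induction rule: dwalk.induct)
    case (start v)
    then show ?case using assms(3,4) by (auto simp: conn_def)
  next
    case (step u t F v)
    let ?Z = "X \<union> snd ` insert (u, v) F"
    have sub: "X \<union> snd ` F \<subseteq> ?Z" by auto
    have u: "u \<in> X \<union> snd ` F" using dwalk_arcs(4)[OF step(1)] .
    have "(r, u) \<in> linked (uadj E) ?Z" using linked_mono[OF _ sub] step.IH u by blast
    moreover have "(u, v) \<in> linked (uadj E) ?Z"
      using u step(2) assms(2) by (intro linked_edge) (auto simp: uadj_def)
    ultimately have v: "(r, v) \<in> linked (uadj E) ?Z" by (rule linked_trans)
    show ?case
    proof
      fix w assume "w \<in> ?Z"
      then consider "w = v" | "w \<in> X \<union> snd ` F" by auto
      then show "(r, w) \<in> linked (uadj E) ?Z"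
        using v linked_mono[OF _ sub] step.IH by cases blast+
    qed
  qed
  then show ?thesis by (intro conn_from[OF symp_uadj, of _ r]) blast
qed

text \<open>The distance from \<open>X\<close> inside \<open>C\<close>, capped at \<open>R\<close>;
  inserting \<open>R\<close> also keeps the infimum meaningful for unreachable vertices.\<close>

definition ddist :: "('a \<times> 'a) set \<Rightarrow> ('a \<times> 'a \<Rightarrow> real) \<Rightarrow> 'a set \<Rightarrow> 'a set \<Rightarrow> real \<Rightarrow> 'a \<Rightarrow> real" where
  "ddist A c X C R v = Inf (insert R {t. \<exists>F. dwalk A c X C v t F})"

context
  fixes A :: "('a \<times> 'a) set" and c :: "'a \<times> 'a \<Rightarrow> real" and X C :: "'a set" and R :: real
  assumes c_nonneg: "\<And>e. e \<in> A \<Longrightarrow> 0 \<le> c e" and R: "0 < R"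
begin

lemma ddist_bdd: "bdd_below (insert R {t. \<exists>F. dwalk A c X C v t F})"
  using R dwalk_cost(1)[OF _ c_nonneg] by (intro bdd_belowI[of _ 0]) auto

lemma ddist_nonneg: "0 \<le> ddist A c X C R v"
  unfolding ddist_def using R dwalk_cost(1)[OF _ c_nonneg] by (intro cInf_greatest) auto

lemma ddist_le: "ddist A c X C R v \<le> R"
  unfolding ddist_def by (intro cInf_lower ddist_bdd) auto

lemma ddist_le_dwalk: "dwalk A c X C v t F \<Longrightarrow> ddist A c X C R v \<le> t"
  unfolding ddist_def by (intro cInf_lower ddist_bdd) auto

lemma ddist_start: "v \<in> X \<Longrightarrow> ddist A c X C R v = 0"
  using ddist_le_dwalk[OF dwalk.start] ddist_nonneg by (intro antisym) auto

lemma ddist_less: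
  assumes "ddist A c X C R v < y" "y \<le> R" shows "\<exists>t F. t < y \<and> dwalk A c X C v t F"
  using assms cInf_less_iff[OF _ ddist_bdd[of v], of y] unfolding ddist_def by auto

lemma ddist_step:
  assumes "(u, v) \<in> A" "v \<in> C" shows "ddist A c X C R v \<le> ddist A c X C R u + c (u, v)"
proof (rule field_le_epsilon)
  fix e :: real assume e: "0 < e"
  show "ddist A c X C R v \<le> ddist A c X C R u + c (u, v) + e"
  proof (cases "ddist A c X C R u + e \<le> R")
    case True
    then obtain t F where "t < ddist A c X C R u + e" "dwalk A c X C u t F"
      using ddist_less[of u "ddist A c X C R u + e"] e by auto
    then show ?thesis using ddist_le_dwalk[OF dwalk.step[OF _ assms]] by fastforce
  next
    case False
    then show ?thesis using ddist_le[of v] c_nonneg[OF assms(1)] by linarith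
  qed
qed

end

section \<open>Cut constraints relative to the bought set\<close>

definition cut :: "('a \<times> 'a) set \<Rightarrow> 'a set \<Rightarrow> 'a set \<Rightarrow> ('a \<times> 'a) set" where
  "cut A C U = {e \<in> A. fst e \<in> U \<and> snd e \<in> C - U}"

text \<open>The arcs that can occur in such cuts. Their heads lie in \<open>C\<close>, so disjoint
  parts have disjoint inner arcs even if tails in \<open>X\<close> are shared.\<close>

definition inner_arcs :: "('a \<times> 'a) set \<Rightarrow> 'a set \<Rightarrow> 'a set \<Rightarrow> ('a \<times> 'a) set" where
  "inner_arcs A X C = {e \<in> A. fst e \<in> X \<union> C \<and> snd e \<in> C}"

text \<open>The cut constraints that remain when \<open>X\<close> is contracted to the root and only
  \<open>C\<close> is left.\<close>

definition covers :: "('a \<times> 'a) set \<Rightarrow> ('a \<times> 'a \<Rightarrow> real) \<Rightarrow> 'a set \<Rightarrow> 'a set \<Rightarrow> 'a set \<Rightarrow> bool" where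
  "covers A x X C S \<longleftrightarrow> (\<forall>U. X \<subseteq> U \<longrightarrow> U \<subseteq> X \<union> C \<longrightarrow> \<not> S \<subseteq> U \<longrightarrow> 1 \<le> sum x (cut A C U))"

text \<open>Integrate the cut constraints of the sets \<open>{v \<in> U. d v < \<theta>}\<close> over the radius \<open>\<theta>\<close>.\<close>

lemma cut_truncation:
  fixes x c :: "'a \<times> 'a \<Rightarrow> real" and d :: "'a \<Rightarrow> real"
  assumes A: "finite A" "\<And>e. e \<in> A \<Longrightarrow> 0 \<le> x e" "\<And>e. e \<in> A \<Longrightarrow> 0 \<le> c e"
    and R: "0 < R" and d: "\<And>v. 0 \<le> d v" "\<And>v. d v \<le> R" "\<And>v. v \<in> X \<Longrightarrow> d v = 0"
      "\<And>u v. (u, v) \<in> A \<Longrightarrow> v \<in> C \<Longrightarrow> d v \<le> d u + c (u, v)"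
    and cov: "covers A x X C S"
    and U: "X \<subseteq> U" "U \<subseteq> X \<union> {v \<in> C. d v < R}" "\<not> S \<subseteq> U"
  shows "R * (1 - sum x (cut A {v \<in> C. d v < R} U)) \<le> (\<Sum>e\<in>inner_arcs A X C. c e * x e)"
proof -
  let ?C = "{v \<in> C. d v < R}" and ?B = "inner_arcs A X C"
  let ?I = "\<lambda>e \<theta>. if \<theta> \<in> {d (fst e)..d (snd e)} then 1 else (0::real)"
  define a where "a = sum x (cut A ?C U)"
  have finB: "finite ?B" "?B \<subseteq> A" using A by (auto simp: inner_arcs_def)
  have ge: "1 \<le> a + (\<Sum>e\<in>?B. x e * ?I e \<theta>)" if \<theta>: "\<theta> \<in> {0<..<R}" for \<theta>
  proof -
    define W where "W = {v \<in> U. d v < \<theta>}"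
    have W: "X \<subseteq> W" "W \<subseteq> X \<union> C" "\<not> S \<subseteq> W" using U d(3) \<theta> by (auto simp: W_def)
    then have "1 \<le> sum x (cut A C W)" using cov by (simp add: covers_def)
    also have "\<dots> \<le> sum x (cut A ?C U \<union> {e \<in> ?B. \<theta> \<in> {d (fst e)..d (snd e)}})"
    proof (rule sum_mono2)
      \<comment> \<open>An arc leaving \<open>W\<close> either leaves \<open>U\<close> within the
        ball, or its head is in \<open>U\<close> outside \<open>W\<close> or is beyond the ball; in
        both latter cases the arc spans the radius \<open>\<theta>\<close>.\<close>
      show "cut A C W \<subseteq> cut A ?C U \<union> {e \<in> ?B. \<theta> \<in> {d (fst e)..d (snd e)}}"
      proof
        fix e assume e: "e \<in> cut A C W"
        obtain u v where uv: "e = (u, v)" by (cases e)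
        have *: "(u, v) \<in> A" "u \<in> U" "d u < \<theta>" "v \<in> C" "v \<in> U \<Longrightarrow> \<theta> \<le> d v"
          using e by (auto simp: cut_def W_def uv)
        show "e \<in> cut A ?C U \<union> {e \<in> ?B. \<theta> \<in> {d (fst e)..d (snd e)}}"
        proof (cases "v \<notin> U \<and> d v < R")
          case True
          then show ?thesis using * by (auto simp: cut_def uv)
        next
          case False
          then have "\<theta> \<le> d v" using * \<theta> by auto
          moreover have "u \<in> X \<union> C" using * U by auto
          ultimately show ?thesis using * by (auto simp: uv inner_arcs_def)
        qed
      qed
    qed (use A finB in \<open>auto simp: cut_def\<close>)
    also have "\<dots> \<le> a + sum x {e \<in> ?B. \<theta> \<in> {d (fst e)..d (snd e)}}"
      unfolding a_def using A finB by (subst sum_Un) (auto simp: cut_def intro!: sum_nonneg)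
    also have "sum x {e \<in> ?B. \<theta> \<in> {d (fst e)..d (snd e)}} = (\<Sum>e\<in>?B. x e * ?I e \<theta>)"
      using finB by (simp add: sum.inter_filter if_distrib cong: if_cong)
    finally show ?thesis .
  qed
  have int_I: "(?I e has_integral measure lborel {d (fst e)..d (snd e)}) {0..R}" for e
    using has_integral_const_real[of "1::real" "d (fst e)" "d (snd e)"] d(1)[of "fst e"] d(2)[of "snd e"]
    by (subst has_integral_restrict) auto
  \<comment> \<open>The bound \<open>ge\<close> is available on the open interval:
    \<open>\<theta> > 0\<close> puts \<open>X\<close> into \<open>W\<close>, and
    \<open>\<theta> < R\<close> handles heads beyond the ball. Dropping endpoints leaves the
    integrals unchanged.\<close>
  have int_1: "((\<lambda>\<theta>. 1) has_integral R) {0<..<R}"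
    using has_integral_const_real[of "1::real" 0 R] R unfolding has_integral_Icc_iff_Ioo by simp
  have "((\<lambda>\<theta>. a + (\<Sum>e\<in>?B. x e * ?I e \<theta>)) has_integral
      (R * a + (\<Sum>e\<in>?B. x e * measure lborel {d (fst e)..d (snd e)}))) {0..R}"
    using has_integral_const_real[of a 0 R] R finB(1) int_I
    by (intro has_integral_add has_integral_sum has_integral_mult_right) auto
  from has_integral_le[OF int_1 this[unfolded has_integral_Icc_iff_Ioo] ge]
  have "R \<le> R * a + (\<Sum>e\<in>?B. x e * measure lborel {d (fst e)..d (snd e)})"
    by simp
  also have "\<dots> \<le> R * a + (\<Sum>e\<in>?B. c e * x e)"
  proof (intro add_left_mono sum_mono)
    fix e assume e: "e \<in> ?B"
    obtain u v where uv: "e = (u, v)" by (cases e)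
    \<comment> \<open>Along an arc, \<open>d\<close> grows by at most its cost.\<close>
    have "measure lborel {d u..d v} \<le> c e"
      using d(4)[of u v] e A(3)[of e] by (cases "d u \<le> d v") (auto simp: uv inner_arcs_def)
    then show "x e * measure lborel {d (fst e)..d (snd e)} \<le> c e * x e"
      unfolding uv fst_conv snd_conv using A(2)[of e] finB e
      by (subst mult.commute, intro mult_right_mono) (auto simp: uv)
  qed
  finally show ?thesis by (simp add: a_def right_diff_distrib)
qed

section \<open>Recursive separation\<close>

text \<open>The factor for fewer than \<open>2 ^ k\<close> terminals: \<open>8 * D\<close> pays for
  one separator, and \<open>D / (D - 1)\<close> is the rescaling that restores the cut constraints
  for the next level.\<close>

fun gap_bound :: "real \<Rightarrow> nat \<Rightarrow> real" where
  "gap_bound D 0 = 0"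
| "gap_bound D (Suc k) = 8 * D + D / (D - 1) * gap_bound D k"

lemma gap_bound_nonneg: "1 < D \<Longrightarrow> 0 \<le> gap_bound D k"
  by (induction k) auto

lemma sum_UN_le:
  fixes f :: "'b \<Rightarrow> real"
  assumes "finite I" "\<And>i. i \<in> I \<Longrightarrow> finite (M i)" "\<And>i y. i \<in> I \<Longrightarrow> y \<in> M i \<Longrightarrow> 0 \<le> f y"
  shows "sum f (\<Union> (M ` I)) \<le> (\<Sum>i\<in>I. sum f (M i))"
  using assms
proof (induction I rule: finite_induct)
  case (insert i I)
  have "sum f (M i \<union> \<Union> (M ` I)) \<le> sum f (M i) + sum f (\<Union> (M ` I))"
    using insert by (subst sum_Un) (auto intro!: sum_nonneg)
  with insert show ?case by force
qed simp

text \<open>\<open>X\<close> is the set of vertices that are already connected to the root, and the terminals of \<open>S\<close> lie in the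
  part \<open>C\<close> of the rest. Truncating to the ball of radius about \<open>D * L\<close> costs a factor \<open>D / (D - 1)\<close> of
  feasibility, and the at most eight walks of the separator have length at most the radius. Deleting them
  halves the number of terminals per component, and the costs \<open>L\<close> of the components add up.\<close>

lemma planar_recursion:
  fixes A :: "('a \<times> 'a) set" and c :: "'a \<times> 'a \<Rightarrow> real"
  assumes pl: "planar_graph V E" and E: "\<And>e. e \<in> E \<Longrightarrow> \<exists>u v. e = {u, v}" and finV: "finite V"
    and finA: "finite A" and AE: "\<And>u v. (u, v) \<in> A \<Longrightarrow> {u, v} \<in> E"
    and c: "\<And>e. e \<in> A \<Longrightarrow> 0 \<le> c e" and D: "1 < D"
    and X: "r \<in> X" "X \<subseteq> V" "conn (uadj E) X" and C: "C \<subseteq> V - X" and S: "S \<subseteq> C" "card S < 2 ^ k"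
    and x: "\<And>e. e \<in> A \<Longrightarrow> 0 \<le> x e" and cov: "covers A x X C S"
  shows "\<exists>F\<subseteq>A. (\<forall>s\<in>S. \<exists>a\<in>X. (a, s) \<in> F\<^sup>*) \<and>
           sum c F \<le> gap_bound D k * (\<Sum>e\<in>inner_arcs A X C. c e * x e)"
  using X C S x cov
proof (induction k arbitrary: X C S x)
  case 0
  have "finite S" using 0 finV by (meson Diff_subset finite_subset)
  then have "S = {}" using 0 by simp
  then show ?case by (intro exI[of _ "{}"]) auto
next
  case (Suc k X C S x)
  define L where "L = (\<Sum>e\<in>inner_arcs A X C. c e * x e)"
  define valid where "valid F \<longleftrightarrow> F \<subseteq> A \<and> (\<forall>s\<in>S. \<exists>a\<in>X. (a, s) \<in> F\<^sup>*)" for F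
  have inner_A: "inner_arcs A Y B \<subseteq> A" for Y B by (auto simp: inner_arcs_def)
  have L0: "0 \<le> L"
    unfolding L_def using inner_A c Suc.prems(7) by (intro sum_nonneg mult_nonneg_nonneg) blast+
  have finC: "finite C" "finite S" using Suc.prems finV by (meson Diff_subset finite_subset)+
  \<comment> \<open>The slack keeps the radius positive when \<open>L = 0\<close>. A share of
    \<open>\<epsilon> / 8\<close> suits the radius because at most eight walks are bought.\<close>
  have eps: "\<exists>F. valid F \<and> sum c F \<le> gap_bound D (Suc k) * L + \<epsilon>" if \<epsilon>: "0 < \<epsilon>" for \<epsilon>
  proof -
    define R where "R = D * L + \<epsilon> / 8"
    have R: "0 < R" using \<epsilon> L0 D by (simp add: R_def add_nonneg_pos)
    have LR: "D * L \<le> R" using \<epsilon> by (simp add: R_def)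
    have "L < R" using mult_right_mono[of 1 D L] D L0 \<epsilon> by (simp add: R_def)
    define d where "d = ddist A c X C R"
    have d: "\<And>v. 0 \<le> d v" "\<And>v. d v \<le> R" "\<And>v. v \<in> X \<Longrightarrow> d v = 0"
      "\<And>u v. (u, v) \<in> A \<Longrightarrow> v \<in> C \<Longrightarrow> d v \<le> d u + c (u, v)"
      unfolding d_def using c R
      by (auto intro!: ddist_nonneg ddist_le ddist_start ddist_step)
    define C' where "C' = {v \<in> C. d v < R}"
    define V' where "V' = X \<union> C'"
    have trunc: "R * (1 - sum x (cut A C' U)) \<le> L" if "X \<subseteq> U" "U \<subseteq> V'" "\<not> S \<subseteq> U" for U
      unfolding L_def C'_def
      by (rule cut_truncation[where d = d and c = c and x = x and R = R and S = S, OF finA _ _ R _ _ _ _ Suc.prems(8)])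
        (use that d c Suc.prems(7) in \<open>auto simp: V'_def C'_def\<close>)
    \<comment> \<open>Otherwise \<open>V'\<close> itself would be an admissible set with an empty
      cut, and truncation would give \<open>R \<le> L\<close>.\<close>
    have SC': "S \<subseteq> C'"
    proof (rule ccontr)
      assume "\<not> S \<subseteq> C'"
      then have "\<not> S \<subseteq> V'" using Suc.prems by (auto simp: V'_def)
      moreover have "cut A C' V' = {}" by (auto simp: cut_def V'_def)
      ultimately show False using trunc[of V'] \<open>L < R\<close> by (simp add: V'_def)
    qed
    have V': "V' \<subseteq> V" "finite V'" "r \<in> V'" "S \<subseteq> V'"
      using Suc.prems finV SC' by (auto simp: V'_def C'_def intro: finite_subset)
    have "\<forall>v\<in>C'. \<exists>t F. t < R \<and> dwalk A c X C v t F"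
      using ddist_less[OF c R, where y = R] by (auto simp: C'_def d_def)
    then obtain t G where tG: "\<And>v. v \<in> C' \<Longrightarrow> t v < R" "\<And>v. v \<in> C' \<Longrightarrow> dwalk A c X C v (t v) (G v)"
      by metis
    \<comment> \<open>\<open>P v\<close> is the bought set extended by a walk to \<open>v\<close>,
      and \<open>F v\<close> holds the arcs that buy it, at cost at most \<open>R\<close>. For
      \<open>v\<close> in \<open>X\<close> it is \<open>X\<close> itself.\<close>
    define F where "F v = (if v \<in> C' then G v else {})" for v
    define P where "P v = X \<union> snd ` F v" for v
    have F_reach: "\<exists>a\<in>X. (a, w) \<in> (F v)\<^sup>*" if "w \<in> P v" for v w
      using that dwalk_reach[OF tG(2)] unfolding P_def F_def by (auto split: if_splits)
    have F_A: "F v \<subseteq> A" "finite (F v)" for v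
      unfolding F_def using dwalk_arcs[OF tG(2)] by auto
    have F_cost: "sum c (F v) \<le> R" for v
      unfolding F_def using dwalk_cost(2)[OF tG(2) c] tG(1) R by (auto intro: order_trans[OF _ less_imp_le])
    have P_sub: "P v \<subseteq> V'" for v
    proof
      fix w assume w: "w \<in> P v"
      show "w \<in> V'"
      proof (cases "w \<in> X")
        case False
        with w have v: "v \<in> C'" and wF: "w \<in> snd ` G v" by (auto simp: P_def F_def split: if_splits)
        obtain t' F' where "t' \<le> t v" "dwalk A c X C w t' F'"
          using dwalk_prefix[OF tG(2)[OF v] c wF] by blast
        then have "d w < R" using ddist_le_dwalk[OF c R] tG(1)[OF v] unfolding d_def by fastforce
        then show ?thesis using dwalk_arcs(3)[OF tG(2)[OF v]] wF by (auto simp: V'_def C'_def)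
      qed (simp add: V'_def)
    qed
    have P_self: "v \<in> P v" if "v \<in> V'" for v
      using that dwalk_arcs(4)[OF tG(2)] by (auto simp: P_def F_def V'_def)
    have P_conn: "conn (uadj E) (P v)" for v
      using dwalk_conn[OF tG(2) AE Suc.prems(1,3)] Suc.prems(3) by (auto simp: P_def F_def)
    have P_r: "r \<in> P v" for v using Suc.prems by (simp add: P_def)
    have "\<exists>Q. Q \<subseteq> V' \<and> Q \<noteq> {} \<and> card Q \<le> 8 \<and>
        (\<forall>K. K \<subseteq> V' - \<Union> (P ` Q) \<longrightarrow> conn (uadj E) K \<longrightarrow> 2 * card (K \<inter> S) \<le> card S)"
      by (rule planar_separator[OF pl _ V'(2,1,3,4)])
        (use E P_sub P_self P_conn P_r in \<open>simp_all only:\<close>)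
    then obtain Q where Q: "Q \<subseteq> V'" "Q \<noteq> {}" "card Q \<le> 8"
      "\<And>K. K \<subseteq> V' - \<Union> (P ` Q) \<Longrightarrow> conn (uadj E) K \<Longrightarrow> 2 * card (K \<inter> S) \<le> card S"
      by auto
    define Z where "Z = \<Union> (P ` Q)"
    define F0 where "F0 = \<Union> (F ` Q)"
    have finQ: "finite Q" using finite_subset[OF Q(1) V'(2)] .
    have F0: "F0 \<subseteq> A" "finite F0" using F_A finQ by (auto simp: F0_def)
    have ZX: "X \<subseteq> Z" using Q(2) by (auto simp: Z_def P_def)
    have ZV': "Z \<subseteq> V'" using P_sub by (auto simp: Z_def)
    have Z_reach: "\<exists>a\<in>X. (a, z) \<in> F0\<^sup>*" if z: "z \<in> Z" for z
    proof -
      obtain v where v: "v \<in> Q" "z \<in> P v" using z by (auto simp: Z_def)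
      have "(F v)\<^sup>* \<subseteq> F0\<^sup>*" using v by (intro rtrancl_mono) (auto simp: F0_def)
      then show ?thesis using F_reach[OF v(2)] by blast
    qed
    have Z_conn: "conn (uadj E) Z"
    proof (rule conn_from[OF symp_uadj, of _ r])
      fix z assume "z \<in> Z"
      then obtain v where v: "v \<in> Q" "z \<in> P v" by (auto simp: Z_def)
      show "(r, z) \<in> linked (uadj E) Z"
        using v by (intro linked_mono[OF connD[OF P_conn P_r v(2)]]) (auto simp: Z_def)
    qed
    have "sum c F0 \<le> (\<Sum>v\<in>Q. sum c (F v))"
      unfolding F0_def using F_A c by (intro sum_UN_le finQ) blast+
    also have "\<dots> \<le> card Q * R" using F_cost by (intro sum_bounded_above) auto
    also have "\<dots> \<le> 8 * R" using Q(3) R by (intro mult_right_mono) auto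
    finally have cost0: "sum c F0 \<le> 8 * R" .
    \<comment> \<open>Components of the ball after deleting the separator; \<open>KK\<close> keeps
      those that contain terminals.\<close>
    define comp where "comp s = {y \<in> V' - Z. (s, y) \<in> linked (uadj E) (V' - Z)}" for s
    define KK where "KK = comp ` (S - Z)"
    have finKK: "finite KK" using finC by (simp add: KK_def)
    have K_sub: "K \<subseteq> V' - Z" if "K \<in> KK" for K using that by (auto simp: KK_def comp_def)
    have K_disj: "K1 \<inter> K2 = {}" if K12: "K1 \<in> KK" "K2 \<in> KK" "K1 \<noteq> K2" for K1 K2
    proof (rule ccontr)
      assume "K1 \<inter> K2 \<noteq> {}"
      then obtain y s1 s2 where y: "K1 = comp s1" "K2 = comp s2" "(s1, y) \<in> linked (uadj E) (V' - Z)"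
        "(s2, y) \<in> linked (uadj E) (V' - Z)" using K12 by (auto simp: KK_def comp_def)
      have s12: "(s1, s2) \<in> linked (uadj E) (V' - Z)"
        by (rule linked_trans[OF y(3) linked_sym[OF symp_uadj y(4)]])
      have s21: "(s2, s1) \<in> linked (uadj E) (V' - Z)"
        by (rule linked_trans[OF y(4) linked_sym[OF symp_uadj y(3)]])
      have "(s1, w) \<in> linked (uadj E) (V' - Z) \<longleftrightarrow> (s2, w) \<in> linked (uadj E) (V' - Z)" for w
        using linked_trans[OF s12] linked_trans[OF s21] by (rule iffI[rotated])
      then have "comp s1 = comp s2" by (simp add: comp_def)
      then show False using y K12 by simp
    qed
    have K_closed: "u \<in> K" if K: "K \<in> KK" and v: "v \<in> K" and u: "u \<in> V' - Z" and uv: "{u, v} \<in> E" for K u v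
    proof -
      obtain s where s: "K = comp s" using K by (auto simp: KK_def)
      have sv: "(s, v) \<in> linked (uadj E) (V' - Z)" and "v \<in> V' - Z" using v by (auto simp: s comp_def)
      have "(v, u) \<in> linked (uadj E) (V' - Z)"
        using u \<open>v \<in> V' - Z\<close> uv by (intro linked_edge) (auto simp: uadj_def insert_commute)
      then show ?thesis using u linked_trans[OF sv] by (simp add: s comp_def)
    qed
    \<comment> \<open>Truncation and \<open>D * L \<le> R\<close> leave at least
      \<open>1 - 1 / D\<close> of each cut, so this factor lifts every cut back to 1.\<close>
    define x' where "x' e = D / (D - 1) * x e" for e
    have x'0: "0 \<le> x' e" if "e \<in> A" for e using Suc.prems(7)[OF that] D by (simp add: x'_def)
    have x'1: "1 \<le> sum x' (cut A C' U)" if "X \<subseteq> U" "U \<subseteq> V'" "\<not> S \<subseteq> U" for U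
    proof -
      define \<sigma> where "\<sigma> = sum x (cut A C' U)"
      have "R * (1 - \<sigma>) \<le> L" using trunc[OF that] by (simp add: \<sigma>_def)
      then have "D * (R * (1 - \<sigma>)) \<le> D * L" using D by (intro mult_left_mono) auto
      then have "R * (D * (1 - \<sigma>)) \<le> R * 1" using LR by (simp add: mult.left_commute)
      then have "D * (1 - \<sigma>) \<le> 1" using R mult_le_cancel_left_pos by blast
      then have "1 \<le> D / (D - 1) * \<sigma>" using D by (simp add: field_simps)
      then show ?thesis unfolding x'_def \<sigma>_def sum_distrib_left .
    qed
    have "\<exists>H\<subseteq>A. (\<forall>s\<in>S \<inter> K. \<exists>a\<in>Z. (a, s) \<in> H\<^sup>*) \<and>
        sum c H \<le> gap_bound D k * (\<Sum>e\<in>inner_arcs A Z K. c e * x' e)" if K: "K \<in> KK" for K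
    proof (rule Suc.IH)
      show "r \<in> Z" "Z \<subseteq> V" "K \<subseteq> V - Z" "S \<inter> K \<subseteq> K"
        using ZX ZV' V' K_sub[OF K] Suc.prems(1) by auto
      show "conn (uadj E) Z" by fact
      obtain s where s: "K = comp s" using K by (auto simp: KK_def)
      have "conn (uadj E) K" unfolding s comp_def by (rule conn_component[OF symp_uadj])
      then have "2 * card (K \<inter> S) \<le> card S" using Q(4) K_sub[OF K] by (simp add: Z_def)
      then show "card (S \<inter> K) < 2 ^ k" using Suc.prems(6) by (simp add: Int_commute)
      show "0 \<le> x' e" if "e \<in> A" for e using x'0[OF that] .
      show "covers A x' Z K (S \<inter> K)" unfolding covers_def
      proof (intro allI impI)
        fix U assume U: "Z \<subseteq> U" "U \<subseteq> Z \<union> K" "\<not> S \<inter> K \<subseteq> U"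
        \<comment> \<open>Adding everything outside \<open>K\<close> turns \<open>U\<close> into a
          cut of the whole ball. Arcs leaving it end in \<open>K\<close>, and by
          \<open>K_closed\<close> they start in \<open>U\<close>.\<close>
        define U' where "U' = U \<union> (V' - K)"
        have "1 \<le> sum x' (cut A C' U')"
          using U ZX ZV' K_sub[OF K] by (intro x'1) (auto simp: U'_def V'_def)
        also have "\<dots> \<le> sum x' (cut A K U)"
        proof (rule sum_mono2)
          show "cut A C' U' \<subseteq> cut A K U"
          proof
            fix e assume e: "e \<in> cut A C' U'"
            obtain u v where uv: "e = (u, v)" by (cases e)
            have *: "(u, v) \<in> A" "u \<in> U'" "v \<in> C'" "v \<notin> U'" using e by (auto simp: cut_def uv)
            then have v: "v \<in> K" "v \<notin> U" by (auto simp: U'_def V'_def)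
            have "u \<in> U"
            proof (rule ccontr)
              assume "u \<notin> U"
              then have "u \<in> V' - Z" "u \<notin> K" using * U by (auto simp: U'_def)
              then show False using K_closed[OF K v(1) _ AE[OF *(1)]] by blast
            qed
            then show "e \<in> cut A K U" using * v by (auto simp: cut_def uv)
          qed
        qed (use finA x'0 in \<open>auto simp: cut_def\<close>)
        finally show "1 \<le> sum x' (cut A K U)" .
      qed
    qed
    then obtain H where H: "\<And>K. K \<in> KK \<Longrightarrow> H K \<subseteq> A"
      "\<And>K s. K \<in> KK \<Longrightarrow> s \<in> S \<inter> K \<Longrightarrow> \<exists>a\<in>Z. (a, s) \<in> (H K)\<^sup>*"
      "\<And>K. K \<in> KK \<Longrightarrow> sum c (H K) \<le> gap_bound D k * (\<Sum>e\<in>inner_arcs A Z K. c e * x' e)"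
      by metis
    define F1 where "F1 = F0 \<union> \<Union> (H ` KK)"
    have F0_sub: "F0\<^sup>* \<subseteq> F1\<^sup>*" by (intro rtrancl_mono) (auto simp: F1_def)
    have "valid F1" unfolding valid_def
    proof (intro conjI ballI)
      show "F1 \<subseteq> A" using F0 H(1) by (auto simp: F1_def)
      fix s assume s: "s \<in> S"
      show "\<exists>a\<in>X. (a, s) \<in> F1\<^sup>*"
      proof (cases "s \<in> Z")
        case True
        then show ?thesis using Z_reach F0_sub by blast
      next
        case False
        then have K: "comp s \<in> KK" "s \<in> S \<inter> comp s" using s V'(4) by (auto simp: KK_def comp_def)
        obtain z where z: "z \<in> Z" "(z, s) \<in> (H (comp s))\<^sup>*" using H(2)[OF K] by blast
        have "(H (comp s))\<^sup>* \<subseteq> F1\<^sup>*" using K by (intro rtrancl_mono) (auto simp: F1_def)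
        then have "(z, s) \<in> F1\<^sup>*" using z by blast
        moreover obtain a where "a \<in> X" "(a, z) \<in> F1\<^sup>*" using Z_reach[OF z(1)] F0_sub by blast
        ultimately show ?thesis using rtrancl_trans by metis
      qed
    qed
    moreover have "sum c F1 \<le> gap_bound D (Suc k) * L + \<epsilon>"
    proof -
      have finH: "finite (H K)" if "K \<in> KK" for K using H(1)[OF that] finA finite_subset by blast
      have "sum c F1 \<le> sum c F0 + sum c (\<Union> (H ` KK))"
        unfolding F1_def using sum_nonneg[of "F0 \<inter> \<Union> (H ` KK)" c] F0 finH finKK c
        by (subst sum_Un) auto
      also have "sum c (\<Union> (H ` KK)) \<le> (\<Sum>K\<in>KK. sum c (H K))"
        using H(1) c finH by (intro sum_UN_le finKK) blast+
      also have "\<dots> \<le> (\<Sum>K\<in>KK. gap_bound D k * (\<Sum>e\<in>inner_arcs A Z K. c e * x' e))"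
        by (intro sum_mono H(3))
      \<comment> \<open>Inner arcs of different components have different heads, so the sums combine
        into one sum over inner arcs of the parent.\<close>
      also have "\<dots> = gap_bound D k * (\<Sum>e\<in>(\<Union>K\<in>KK. inner_arcs A Z K). c e * x' e)"
      proof (subst sum.UNION_disjoint)
        show "\<forall>K\<in>KK. \<forall>K'\<in>KK. K \<noteq> K' \<longrightarrow> inner_arcs A Z K \<inter> inner_arcs A Z K' = {}"
          using K_disj by (fastforce simp: inner_arcs_def)
      qed (use finKK finA finite_subset[OF inner_A] in \<open>auto simp: sum_distrib_left\<close>)
      also have "\<dots> \<le> gap_bound D k * (\<Sum>e\<in>inner_arcs A X C. c e * x' e)"
      proof (intro mult_left_mono sum_mono2)
        show "(\<Union>K\<in>KK. inner_arcs A Z K) \<subseteq> inner_arcs A X C"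
          using K_sub ZV' ZX by (fastforce simp: inner_arcs_def V'_def C'_def)
        show "0 \<le> c e * x' e" if "e \<in> inner_arcs A X C - (\<Union>K\<in>KK. inner_arcs A Z K)" for e
          using that c[of e] x'0[of e] by (auto simp: inner_arcs_def)
      qed (use finA finite_subset[OF inner_A] gap_bound_nonneg[OF D] in auto)
      also have "(\<Sum>e\<in>inner_arcs A X C. c e * x' e) = D / (D - 1) * L"
        unfolding x'_def L_def sum_distrib_left by (simp add: mult.left_commute)
      finally have "sum c F1 \<le> 8 * R + gap_bound D k * (D / (D - 1) * L)" using cost0 by simp
      then show ?thesis by (simp add: R_def algebra_simps)
    qed
    ultimately show ?thesis by blast
  qed
  \<comment> \<open>There are finitely many valid arc sets, so the cheapest one meets the bound for
    every slack, hence without slack.\<close>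
  have fin_valid: "finite {F. valid F}" "{F. valid F} \<noteq> {}"
    using finite_subset[of "{F. valid F}" "Pow A"] finA eps[of 1] by (auto simp: valid_def)
  define m where "m = Min (sum c ` {F. valid F})"
  have "m \<in> sum c ` {F. valid F}" unfolding m_def using fin_valid by (intro Min_in) auto
  then obtain F where F: "valid F" "sum c F = m" by blast
  have "sum c F \<le> gap_bound D (Suc k) * L"
  proof (rule field_le_epsilon)
    fix \<epsilon> :: real assume "0 < \<epsilon>"
    then obtain F' where "valid F'" "sum c F' \<le> gap_bound D (Suc k) * L + \<epsilon>" using eps by blast
    moreover have "m \<le> sum c F'" unfolding m_def using \<open>valid F'\<close> fin_valid by (intro Min_le) auto
    ultimately show "sum c F \<le> gap_bound D (Suc k) * L + \<epsilon>" using F by simp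
  qed
  then show ?case using F(1) unfolding valid_def L_def by blast
qed

text \<open>For \<open>D = m + 1\<close> the rescaling factor is \<open>1 + 1 / m\<close>, and its
  power with exponent \<open>m\<close> is at most \<open>exp 1\<close>, hence at most 3; so 24 is
  \<open>8 * 3\<close>.\<close>

lemma gap_bound_le:
  assumes "0 < m" shows "gap_bound (real m + 1) m \<le> 24 * real m * (real m + 1)"
proof -
  define q where "q = 1 + 1 / real m"
  have q: "(real m + 1) / (real m + 1 - 1) = q" "1 \<le> q" using assms by (simp_all add: q_def field_simps)
  have "gap_bound (real m + 1) k \<le> 8 * (real m + 1) * (real k * q ^ k)" for k
  proof (induction k)
    case (Suc k)
    have "gap_bound (real m + 1) (Suc k) \<le> 8 * (real m + 1) * 1 + q * (8 * (real m + 1) * (real k * q ^ k))"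
      unfolding gap_bound.simps q(1) using Suc q(2) by (intro add_mono mult_left_mono) auto
    also have "\<dots> \<le> 8 * (real m + 1) * q ^ Suc k + q * (8 * (real m + 1) * (real k * q ^ k))"
      using q(2) by (intro add_right_mono mult_left_mono one_le_power) auto
    also have "\<dots> = 8 * (real m + 1) * (real (Suc k) * q ^ Suc k)"
      by (simp add: algebra_simps)
    finally show ?case .
  qed simp
  then have "gap_bound (real m + 1) m \<le> 8 * (real m + 1) * (real m * q ^ m)" .
  also have "q ^ m \<le> exp (1 / real m) ^ m"
    unfolding q_def by (intro power_mono exp_ge_add_one_self) auto
  then have "q ^ m \<le> 3"
    using assms exp_le by (simp flip: exp_of_nat_mult)
  then have "8 * (real m + 1) * (real m * q ^ m) \<le> 8 * (real m + 1) * (real m * 3)"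
    by (intro mult_left_mono) auto
  finally show ?thesis by (simp add: mult_ac)
qed

section \<open>Out-trees inside reachable arc sets\<close>

lemma awalk_snoc_iff:
  assumes "pair_wf_digraph T"
  shows "pre_digraph.awalk (with_proj T) x (p @ [(a, b)]) y \<longleftrightarrow>
    pre_digraph.awalk (with_proj T) x p a \<and> (a, b) \<in> parcs T \<and> y = b"
proof -
  interpret pair_wf_digraph T by fact
  show ?thesis
  proof (induction p arbitrary: x)
    case Nil
    show ?case using in_arcsD1[of a b] in_arcsD2[of a b] by (auto simp: awalk_simps)
  next
    case (Cons e p)
    then show ?case by (auto simp: awalk_simps)
  qed
qed

lemma awalk_Nil_iff':
  "pre_digraph.awalk (with_proj T) x [] y \<longleftrightarrow> x = y \<and> x \<in> pverts T"
  by (auto simp: pre_digraph.awalk_def pre_digraph.cas.simps)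

text \<open>No arc leaves \<open>v\<close>, so the new arc can only come last: walks to
  \<open>v\<close> are walks to \<open>u\<close> followed by it, and all other walks are
  unchanged.\<close>

lemma out_tree_extend:
  fixes T :: "'a pair_pre_digraph"
  assumes T: "out_tree r T" and u: "u \<in> pverts T" and v: "v \<notin> pverts T"
  defines "T' \<equiv> \<lparr>pverts = insert v (pverts T), parcs = insert (u, v) (parcs T)\<rparr>"
  shows "out_tree r T'"
proof -
  have wf: "pair_wf_digraph T" and r: "r \<in> pverts T"
    and uniq: "\<And>y. y \<in> pverts T \<Longrightarrow> \<exists>!q. pre_digraph.awalk (with_proj T) r q y"
    using T by (auto simp: out_tree_def)
  have arcs: "a \<in> pverts T" "b \<in> pverts T" if "(a, b) \<in> parcs T" for a b
    using pair_wf_digraph.in_arcsD1[OF wf that] pair_wf_digraph.in_arcsD2[OF wf that] by auto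
  have wf': "pair_wf_digraph T'"
    unfolding T'_def using arcs u by unfold_locales auto
  have fwd: "pre_digraph.awalk (with_proj T) r q y \<Longrightarrow> pre_digraph.awalk (with_proj T') r q y" for q y
  proof (induction q arbitrary: y rule: rev_induct)
    case Nil
    then show ?case by (auto simp: awalk_Nil_iff' T'_def)
  next
    case (snoc e q)
    obtain a b where e: "e = (a, b)" by (cases e)
    show ?case
      using snoc unfolding e awalk_snoc_iff[OF wf] awalk_snoc_iff[OF wf'] by (simp add: T'_def)
  qed
  have bwd: "pre_digraph.awalk (with_proj T') r q y \<Longrightarrow>
      (if y = v then \<exists>q'. q = q' @ [(u, v)] \<and> pre_digraph.awalk (with_proj T) r q' u
       else pre_digraph.awalk (with_proj T) r q y)" for q y
  proof (induction q arbitrary: y rule: rev_induct)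
    case Nil
    then show ?case using r v by (auto simp: awalk_Nil_iff')
  next
    case (snoc e q)
    obtain a b where e: "e = (a, b)" by (cases e)
    have *: "pre_digraph.awalk (with_proj T') r q a" "(a, b) \<in> insert (u, v) (parcs T)" "y = b"
      using snoc.prems unfolding e awalk_snoc_iff[OF wf'] by (simp_all add: T'_def)
    have "a \<noteq> v" using * u v arcs by auto
    then have aw: "pre_digraph.awalk (with_proj T) r q a" using snoc.IH[OF *(1)] by simp
    show ?case
    proof (cases "(a, b) \<in> parcs T")
      case True
      then have "y \<noteq> v" using arcs v * by auto
      then show ?thesis using aw True * by (simp add: e awalk_snoc_iff[OF wf])
    next
      case False
      then show ?thesis using aw * e by auto
    qed
  qed
  show ?thesis unfolding out_tree_def
  proof (intro conjI ballI)
    show "r \<in> pverts T'" using r by (simp add: T'_def)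
    fix y assume "y \<in> pverts T'"
    then consider "y = v" | "y \<noteq> v" "y \<in> pverts T" by (auto simp: T'_def)
    then show "\<exists>!q. pre_digraph.awalk (with_proj T') r q y"
    proof cases
      case 1
      obtain q where q: "pre_digraph.awalk (with_proj T) r q u" using uniq[OF u] by blast
      show ?thesis
      proof (rule ex1I[of _ "q @ [(u, v)]"])
        show "pre_digraph.awalk (with_proj T') r (q @ [(u, v)]) y"
          using fwd[OF q] 1 unfolding awalk_snoc_iff[OF wf'] by (simp add: T'_def)
        show "q' = q @ [(u, v)]" if "pre_digraph.awalk (with_proj T') r q' y" for q'
          using bwd[OF that] 1 uniq[OF u] q by auto
      qed
    next
      case 2
      then show ?thesis using uniq[OF 2(2)] fwd bwd by (metis (no_types, lifting))
    qed
  qed (rule wf')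
qed

text \<open>Take an out-tree inside \<open>F\<close> with the most vertices. An arc of
  \<open>F\<close> leaving it would enlarge it by \<open>out_tree_extend\<close>, so it contains all
  that \<open>F\<close> reaches from \<open>r\<close>.\<close>

lemma r_tree_exists:
  fixes G :: "'a pair_pre_digraph"
  assumes G: "pair_fin_digraph G" and r: "r \<in> pverts G" and F: "F \<subseteq> parcs G"
    and S: "\<And>s. s \<in> S \<Longrightarrow> (r, s) \<in> F\<^sup>*"
  shows "\<exists>T. r_tree G r T \<and> S \<subseteq> pverts T \<and> parcs T \<subseteq> F"
proof -
  interpret pair_fin_digraph G by fact
  define ok where "ok T \<longleftrightarrow> out_tree r T \<and> pverts T \<subseteq> pverts G \<and> parcs T \<subseteq> F" for T
  have "pair_wf_digraph \<lparr>pverts = {r}, parcs = {}\<rparr>" by unfold_locales auto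
  moreover have "\<exists>!q. pre_digraph.awalk (with_proj \<lparr>pverts = {r}, parcs = {}\<rparr>) r q r"
    by (rule ex1I[of _ "[]"]) (auto simp: pre_digraph.awalk_def pre_digraph.cas.simps)
  ultimately have ok0: "ok \<lparr>pverts = {r}, parcs = {}\<rparr>"
    using r by (simp add: ok_def out_tree_def)
  have bound: "card (pverts T) \<le> card (pverts G)" if "ok T" for T
    using that pair_finite_verts by (auto simp: ok_def intro: card_mono)
  have "\<exists>T. ok T \<and> (\<forall>T'. ok T' \<longrightarrow> card (pverts T') \<le> card (pverts T))"
    using ok0 bound
    by (intro ex_has_greatest_nat[where P = ok and b = "Suc (card (pverts G))"]) (auto simp: less_Suc_eq_le)
  then obtain T where T: "ok T" "\<And>T'. ok T' \<Longrightarrow> card (pverts T') \<le> card (pverts T)"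
    by blast
  have finT: "finite (pverts T)" using T(1) finite_subset[OF _ pair_finite_verts] by (auto simp: ok_def)
  have closed: "v \<in> pverts T" if u: "u \<in> pverts T" and uv: "(u, v) \<in> F" for u v
  proof (rule ccontr)
    assume v: "v \<notin> pverts T"
    let ?T' = "\<lparr>pverts = insert v (pverts T), parcs = insert (u, v) (parcs T)\<rparr>"
    have "ok ?T'"
      using T(1) out_tree_extend[OF _ u v] uv F in_arcsD2[of u v] by (auto simp: ok_def)
    then show False using T(2) finT v by fastforce
  qed
  have "s \<in> pverts T" if "(r, s) \<in> F\<^sup>*" for s
    using that by (induction rule: rtrancl_induct) (use closed T(1) in \<open>auto simp: ok_def out_tree_def\<close>)
  moreover have "r_tree G r T"
    unfolding r_tree_def subgraph_def
    using T(1) F wf_digraph wf_digraph_wp_iff[of T] by (auto simp: ok_def out_tree_def compatible_def)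
  ultimately show ?thesis using T(1) S by (auto simp: ok_def)
qed

section \<open>The integrality gap\<close>

text \<open>For positive \<open>k\<close>, the number of binary digits of \<open>k\<close>.\<close>

definition log_levels :: "nat \<Rightarrow> nat" where
  "log_levels k = nat \<lfloor>log 2 (real k)\<rfloor> + 1"

lemma less_log_levels: "k < 2 ^ log_levels k"
proof (cases "k = 0")
  case False
  then have "0 \<le> log 2 (real k)" by simp
  then have "log 2 (real k) < real (log_levels k)" by (simp add: log_levels_def) linarith
  then have "real k < 2 powr real (log_levels k)" using False by (subst (asm) log_less_iff) auto
  then have "real k < real (2 ^ log_levels k)" by (simp add: powr_realpow)
  then show ?thesis by (simp only: of_nat_less_iff)
qed simp

lemma log_levels_bigo:
  "(\<lambda>k. 24 * real (log_levels k) * (real (log_levels k) + 1)) \<in> O(\<lambda>k. (ln (real k))\<^sup>2)"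
proof (rule bigoI[where c = "144 / (ln 2)\<^sup>2"], rule eventually_sequentiallyI[of 2])
  fix k :: nat assume k: "2 \<le> k"
  define l where "l = log 2 (real k)"
  have l: "1 \<le> l" using k by (simp add: l_def le_log_iff)
  have m: "real (log_levels k) \<le> l + 1" using l by (simp add: log_levels_def l_def)
  \<comment> \<open>From \<open>1 \<le> l\<close>, which is where \<open>2 \<le> k\<close> enters,
    the factors are at most \<open>2 * l\<close> and \<open>3 * l\<close>; 144 is
    \<open>24 * 2 * 3\<close>.\<close>
  have "real (log_levels k) * (real (log_levels k) + 1) \<le> (2 * l) * (3 * l)"
    using l m by (intro mult_mono) auto
  then have "24 * real (log_levels k) * (real (log_levels k) + 1) \<le> 144 * l\<^sup>2"
    by (simp add: power2_eq_square)
  also have "\<dots> = 144 / (ln 2)\<^sup>2 * (ln (real k))\<^sup>2"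
    by (simp add: l_def log_def power_divide)
  finally show "norm (24 * real (log_levels k) * (real (log_levels k) + 1)) \<le>
      144 / (ln 2)\<^sup>2 * norm ((ln (real k))\<^sup>2)" by simp
qed

theorem theorem1p2:
  shows "\<exists>f :: nat \<Rightarrow> real. f \<in> O(\<lambda>k. (ln (real k))\<^sup>2) \<and>
    (\<forall>(G :: 'a pair_pre_digraph) (c :: 'a \<times> 'a \<Rightarrow> real) (r :: 'a) (S :: 'a set) (x :: 'a \<times> 'a \<Rightarrow> real).
       pair_fin_digraph G \<and> planar_digraph G \<and> (\<forall>e\<in>parcs G. c e \<ge> 0) \<and>
       r \<in> pverts G \<and> S \<subseteq> pverts G - {r} \<and> lp_feasible G r S x \<longrightarrow>
       (\<exists>T :: 'a pair_pre_digraph. r_tree G r T \<and> S \<subseteq> pverts T \<and>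
          (\<Sum>e\<in>parcs T. c e) \<le> f (card S) * (\<Sum>e\<in>parcs G. c e * x e)))"
proof (rule exI[of _ "\<lambda>k. 24 * real (log_levels k) * (real (log_levels k) + 1)"], intro conjI allI impI)
  show "(\<lambda>k. 24 * real (log_levels k) * (real (log_levels k) + 1)) \<in> O(\<lambda>k. (ln (real k))\<^sup>2)"
    by (rule log_levels_bigo)
next
  fix G :: "'a pair_pre_digraph" and c x :: "'a \<times> 'a \<Rightarrow> real" and r :: 'a and S :: "'a set"
  assume *: "pair_fin_digraph G \<and> planar_digraph G \<and> (\<forall>e\<in>parcs G. c e \<ge> 0) \<and>
       r \<in> pverts G \<and> S \<subseteq> pverts G - {r} \<and> lp_feasible G r S x"
  then interpret pair_fin_digraph G by simp
  have c: "\<And>e. e \<in> parcs G \<Longrightarrow> 0 \<le> c e" and r: "r \<in> pverts G" and S: "S \<subseteq> pverts G - {r}"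
    and x: "\<And>e. e \<in> parcs G \<Longrightarrow> 0 \<le> x e"
    using * by (auto simp: lp_feasible_def)
  let ?m = "log_levels (card S)"
  have m: "0 < ?m" by (simp add: log_levels_def)
  \<comment> \<open>Initially only the root is bought. The head of an arc leaving \<open>U\<close>
    is a vertex other than \<open>r\<close>, since \<open>r\<close> lies in
    \<open>U\<close>.\<close>
  have cov: "covers (parcs G) x {r} (pverts G - {r}) S"
    unfolding covers_def
  proof (intro allI impI)
    fix U assume U: "{r} \<subseteq> U" "U \<subseteq> {r} \<union> (pverts G - {r})" "\<not> S \<subseteq> U"
    then have "U \<in> steiner_cuts G r S" using r by (auto simp: steiner_cuts_def)
    moreover have "delta_out G U = cut (parcs G) (pverts G - {r}) U"
      using U in_arcsD2 by (fastforce simp: delta_out_def cut_def)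
    ultimately show "1 \<le> sum x (cut (parcs G) (pverts G - {r}) U)"
      using * by (auto simp: lp_feasible_def)
  qed
  \<comment> \<open>Taking \<open>D\<close> one larger than the number of levels keeps the
    accumulated rescaling bounded by a constant.\<close>
  have "\<exists>F\<subseteq>parcs G. (\<forall>s\<in>S. \<exists>a\<in>{r}. (a, s) \<in> F\<^sup>*) \<and>
      sum c F \<le> gap_bound (real ?m + 1) ?m * (\<Sum>e\<in>inner_arcs (parcs G) {r} (pverts G - {r}). c e * x e)"
  proof (rule planar_recursion)
    show "planar_graph (pverts G) (underlying_edges G)" using * by (simp add: planar_digraph_def)
    show "conn (uadj (underlying_edges G)) {r}" by (simp add: conn_def)
  qed (use r S x c m cov pair_finite_verts pair_finite_arcs less_log_levels in \<open>auto simp: underlying_edges_def\<close>)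
  then obtain F where F: "F \<subseteq> parcs G" "\<And>s. s \<in> S \<Longrightarrow> (r, s) \<in> F\<^sup>*"
    "sum c F \<le> gap_bound (real ?m + 1) ?m * (\<Sum>e\<in>inner_arcs (parcs G) {r} (pverts G - {r}). c e * x e)"
    by blast
  obtain T where T: "r_tree G r T" "S \<subseteq> pverts T" "parcs T \<subseteq> F"
    using r_tree_exists[OF pair_fin_digraph r F(1,2)] by blast
  have "(\<Sum>e\<in>parcs T. c e) \<le> sum c F"
    using T(3) F(1) c by (intro sum_mono2 finite_subset[OF F(1) pair_finite_arcs]) blast+
  also note F(3)
  also have "gap_bound (real ?m + 1) ?m * (\<Sum>e\<in>inner_arcs (parcs G) {r} (pverts G - {r}). c e * x e)
      \<le> (24 * real ?m * (real ?m + 1)) * (\<Sum>e\<in>parcs G. c e * x e)"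
    using c x pair_finite_arcs
    by (intro mult_mono gap_bound_le m sum_mono2 sum_nonneg) (auto simp: inner_arcs_def)
  finally have "(\<Sum>e\<in>parcs T. c e) \<le> 24 * real ?m * (real ?m + 1) * (\<Sum>e\<in>parcs G. c e * x e)" .
  with T(1,2) show "\<exists>T. r_tree G r T \<and> S \<subseteq> pverts T \<and>
      (\<Sum>e\<in>parcs T. c e) \<le> 24 * real ?m * (real ?m + 1) * (\<Sum>e\<in>parcs G. c e * x e)"
    by (intro exI[of _ T] conjI)
qed

end
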